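(* Let $\Lambda$ be a locally convex row-finite $k$-graph. If $C^*(\Lambda)$ decomposes as a direct sum $C^*(\Lambda)=A\oplus B$ of ideals, then both $A$ and $B$ are gauge-invariant ideals of $C^*(\Lambda)$.
   Context: Fix an integer $k\ge 1$. $\mathbb{N}^k$ carries the coordinatewise order, with standard generators $e_1,\dots,e_k$. A $k$-graph is a countable small category $\Lambda$ with range and source maps $r,s$ and a degree functor $d:\Lambda\to\mathbb{N}^k$ such that whenever $d(\lambda)=m+n$ there are unique $\mu,\nu\in\Lambda$ with $d(\mu)=m$, $d(\nu)=n$, $\lambda=\mu\nu$ (the product $\mu\nu$ is defined iff $s(\mu)=r(\nu)$). $\Lambda^n:=d^{-1}(n)$, and $\Lambda^0$ is the set of vertices. For $v\in\Lambda^0$, $E\subseteq\Lambda$: $vE=\{\mu\in E:r(\mu)=v\}$. $\Lambda$ is row-finite if every $v\Lambda^n$ is finite; locally convex if for all $v$, $i\ne j$, $\lambda\in v\Lambda^{e_i}$, $\mu\in v\Lambda^{e_j}$ we have $s(\lambda)\Lambda^{e_j}\neq\emptyset$ and $s(\mu)\Lambda^{e_i}\ne\emptyset$. $\Lambda^{\le n}:=\{\lambda: d(\lambda)\le n,\text{ and } d(\lambda)_i<n_i\Rightarrow s(\lambda)\Lambda^{e_i}=\emptyset\}$. $C^*(\Lambda)$ is the universal $C^*$-algebra generated by partial isometries $\{s_\lambda:\lambda\in\Lambda\}$ with: $s_vs_w=\delta_{v,w}s_v$ ($v,w\in\Lambda^0$); $s_\lambda s_{\lambda'}=s_{\lambda\lambda'}$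 if $s(\lambda)=r(\lambda')$; $s_\lambda^*s_\lambda=s_{s(\lambda)}$; $s_v=\sum_{\lambda\in v\Lambda^{\le n}}s_\lambda s_\lambda^*$ for all $v\in\Lambda^0,n\in\mathbb{N}^k$. The gauge action $\gamma:\mathbb{T}^k\to\mathrm{Aut}\,C^*(\Lambda)$ is determined by $\gamma_t(s_\lambda)=t^{d(\lambda)}s_\lambda$, where $t^{m}=\prod_i t_i^{m_i}$. Ideals are closed and two-sided. An ideal $I$ is gauge-invariant if $\gamma_t(I)\subseteq I$ for every $t\in\mathbb{T}^k$. *)

theory Defs
  imports "HOL-Analysis.Analysis" "HOL-Algebra.Module" "HOL-Algebra.AbelCoset"
begin

section \<open>Higher-rank graphs\<close>

text \<open>
  A small category is given by its morphisms alone: objects are identified with their identity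
  morphisms, so \<open>rng\<close> and \<open>src\<close> take values in the identities. The composite \<open>cmp \<mu> \<nu>\<close> is
  meaningful iff \<open>src \<mu> = rng \<nu>\<close>. The rank is the cardinality of the (nonempty) finite
  type \<open>'k\<close>, and \<open>nat ^ 'k\<close> carries the coordinatewise order.
\<close>

record ('l, 'k) kgraph_data =
  mor :: "'l set"
  rng :: "'l \<Rightarrow> 'l"
  src :: "'l \<Rightarrow> 'l"
  cmp :: "'l \<Rightarrow> 'l \<Rightarrow> 'l"
  deg :: "'l \<Rightarrow> nat ^ 'k"

locale kgraph =
  fixes \<Lambda> :: "('l, 'k::finite) kgraph_data"
  assumes countable_mor: "countable (mor \<Lambda>)"
    and rng_mor: "\<And>l. l \<in> mor \<Lambda> \<Longrightarrow> rng \<Lambda> l \<in> mor \<Lambda>"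
    and src_mor: "\<And>l. l \<in> mor \<Lambda> \<Longrightarrow> src \<Lambda> l \<in> mor \<Lambda>"
    and rng_rng: "\<And>l. l \<in> mor \<Lambda> \<Longrightarrow> rng \<Lambda> (rng \<Lambda> l) = rng \<Lambda> l"
    and src_rng: "\<And>l. l \<in> mor \<Lambda> \<Longrightarrow> src \<Lambda> (rng \<Lambda> l) = rng \<Lambda> l"
    and rng_src: "\<And>l. l \<in> mor \<Lambda> \<Longrightarrow> rng \<Lambda> (src \<Lambda> l) = src \<Lambda> l"
    and src_src: "\<And>l. l \<in> mor \<Lambda> \<Longrightarrow> src \<Lambda> (src \<Lambda> l) = src \<Lambda> l"
    and cmp_mor: "\<And>\<mu> \<nu>. \<lbrakk>\<mu> \<in> mor \<Lambda>; \<nu> \<in> mor \<Lambda>; src \<Lambda> \<mu> = rng \<Lambda> \<nu>\<rbrakk> \<Longrightarrow> cmp \<Lambda> \<mu> \<nu> \<in> mor \<Lambda>"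
    and rng_cmp: "\<And>\<mu> \<nu>. \<lbrakk>\<mu> \<in> mor \<Lambda>; \<nu> \<in> mor \<Lambda>; src \<Lambda> \<mu> = rng \<Lambda> \<nu>\<rbrakk>
                    \<Longrightarrow> rng \<Lambda> (cmp \<Lambda> \<mu> \<nu>) = rng \<Lambda> \<mu>"
    and src_cmp: "\<And>\<mu> \<nu>. \<lbrakk>\<mu> \<in> mor \<Lambda>; \<nu> \<in> mor \<Lambda>; src \<Lambda> \<mu> = rng \<Lambda> \<nu>\<rbrakk>
                    \<Longrightarrow> src \<Lambda> (cmp \<Lambda> \<mu> \<nu>) = src \<Lambda> \<nu>"
    and cmp_rng: "\<And>l. l \<in> mor \<Lambda> \<Longrightarrow> cmp \<Lambda> (rng \<Lambda> l) l = l"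
    and cmp_src: "\<And>l. l \<in> mor \<Lambda> \<Longrightarrow> cmp \<Lambda> l (src \<Lambda> l) = l"
    and cmp_assoc: "\<And>\<kappa> \<mu> \<nu>. \<lbrakk>\<kappa> \<in> mor \<Lambda>; \<mu> \<in> mor \<Lambda>; \<nu> \<in> mor \<Lambda>;
                      src \<Lambda> \<kappa> = rng \<Lambda> \<mu>; src \<Lambda> \<mu> = rng \<Lambda> \<nu>\<rbrakk>
                    \<Longrightarrow> cmp \<Lambda> (cmp \<Lambda> \<kappa> \<mu>) \<nu> = cmp \<Lambda> \<kappa> (cmp \<Lambda> \<mu> \<nu>)"
    and deg_rng: "\<And>l. l \<in> mor \<Lambda> \<Longrightarrow> deg \<Lambda> (rng \<Lambda> l) = 0"
    and deg_src: "\<And>l. l \<in> mor \<Lambda> \<Longrightarrow> deg \<Lambda> (src \<Lambda> l) = 0"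
    and deg_cmp: "\<And>\<mu> \<nu>. \<lbrakk>\<mu> \<in> mor \<Lambda>; \<nu> \<in> mor \<Lambda>; src \<Lambda> \<mu> = rng \<Lambda> \<nu>\<rbrakk>
                    \<Longrightarrow> deg \<Lambda> (cmp \<Lambda> \<mu> \<nu>) = deg \<Lambda> \<mu> + deg \<Lambda> \<nu>"
    and factorisation: "\<And>l m n. \<lbrakk>l \<in> mor \<Lambda>; deg \<Lambda> l = m + n\<rbrakk>
                    \<Longrightarrow> \<exists>!(\<mu>, \<nu>). \<mu> \<in> mor \<Lambda> \<and> \<nu> \<in> mor \<Lambda> \<and> src \<Lambda> \<mu> = rng \<Lambda> \<nu> \<and>
                          deg \<Lambda> \<mu> = m \<and> deg \<Lambda> \<nu> = n \<and> l = cmp \<Lambda> \<mu> \<nu>"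

definition paths :: "('l, 'k::finite) kgraph_data \<Rightarrow> nat ^ 'k \<Rightarrow> 'l set" where
  "paths \<Lambda> n = {l \<in> mor \<Lambda>. deg \<Lambda> l = n}"

definition vertices :: "('l, 'k::finite) kgraph_data \<Rightarrow> 'l set" where
  "vertices \<Lambda> = paths \<Lambda> 0"

definition range_in :: "('l, 'k::finite) kgraph_data \<Rightarrow> 'l \<Rightarrow> 'l set \<Rightarrow> 'l set" where
  "range_in \<Lambda> v E = {\<mu> \<in> E. rng \<Lambda> \<mu> = v}"

definition paths_le :: "('l, 'k::finite) kgraph_data \<Rightarrow> nat ^ 'k \<Rightarrow> 'l set" where
  "paths_le \<Lambda> n = {l \<in> mor \<Lambda>. deg \<Lambda> l \<le> n \<and>
     (\<forall>i. deg \<Lambda> l $ i < n $ i \<longrightarrow> range_in \<Lambda> (src \<Lambda> l) (paths \<Lambda> (axis i 1)) = {})}"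

definition row_finite :: "('l, 'k::finite) kgraph_data \<Rightarrow> bool" where
  "row_finite \<Lambda> \<longleftrightarrow> (\<forall>v \<in> vertices \<Lambda>. \<forall>n. finite (range_in \<Lambda> v (paths \<Lambda> n)))"

definition locally_convex :: "('l, 'k::finite) kgraph_data \<Rightarrow> bool" where
  "locally_convex \<Lambda> \<longleftrightarrow>
     (\<forall>v \<in> vertices \<Lambda>. \<forall>i j. i \<noteq> j \<longrightarrow>
        (\<forall>l \<in> range_in \<Lambda> v (paths \<Lambda> (axis i 1)). \<forall>\<mu> \<in> range_in \<Lambda> v (paths \<Lambda> (axis j 1)).
           range_in \<Lambda> (src \<Lambda> l) (paths \<Lambda> (axis j 1)) \<noteq> {} \<and>
           range_in \<Lambda> (src \<Lambda> \<mu>) (paths \<Lambda> (axis i 1)) \<noteq> {}))"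

text \<open>The vertices, defined as the morphisms of degree zero, are exactly the identities.\<close>

lemma (in kgraph) vertices_iff_identity:
  "v \<in> vertices \<Lambda> \<longleftrightarrow> v \<in> mor \<Lambda> \<and> rng \<Lambda> v = v"
proof
  assume v: "v \<in> vertices \<Lambda>"
  then have m: "v \<in> mor \<Lambda>" and d: "deg \<Lambda> v = 0"
    by (auto simp: vertices_def paths_def)
  then have "deg \<Lambda> v = 0 + 0" by simp
  from factorisation[OF m this]
  have uniq: "\<And>a b a' b'. \<lbrakk>a \<in> mor \<Lambda>; b \<in> mor \<Lambda>; src \<Lambda> a = rng \<Lambda> b; deg \<Lambda> a = 0; deg \<Lambda> b = 0;
      v = cmp \<Lambda> a b; a' \<in> mor \<Lambda>; b' \<in> mor \<Lambda>; src \<Lambda> a' = rng \<Lambda> b'; deg \<Lambda> a' = 0;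
      deg \<Lambda> b' = 0; v = cmp \<Lambda> a' b'\<rbrakk> \<Longrightarrow> a = a'"
    by blast
  have "rng \<Lambda> v = v"
    using uniq[of "rng \<Lambda> v" v v "src \<Lambda> v"] m d
    by (simp add: rng_mor src_mor src_rng rng_src deg_rng deg_src cmp_rng cmp_src)
  with m show "v \<in> mor \<Lambda> \<and> rng \<Lambda> v = v" by simp
next
  assume "v \<in> mor \<Lambda> \<and> rng \<Lambda> v = v"
  then show "v \<in> vertices \<Lambda>"
    using deg_rng[of v] by (simp add: vertices_def paths_def)
qed


section \<open>C*-algebras\<close>

text \<open>
  C*-algebras need not be unital. The field \<open>one\<close>, inherited from the ring records of HOL-Algebra,
  is never used.
\<close>

record 'a cstar = "(complex, 'a) module" +
  adj :: "'a \<Rightarrow> 'a"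
  nrm :: "'a \<Rightarrow> real"

text \<open>The value outside the carrier only serves to meet the axioms of \<open>Metric_space\<close>.\<close>

definition cdist :: "('a, 'm) cstar_scheme \<Rightarrow> 'a \<Rightarrow> 'a \<Rightarrow> real" where
  "cdist A x y = (if x \<in> carrier A \<and> y \<in> carrier A then nrm A (x \<ominus>\<^bsub>A\<^esub> y) else 0)"

abbreviation ctopology :: "('a, 'm) cstar_scheme \<Rightarrow> 'a topology" where
  "ctopology A \<equiv> Metric_space.mtopology (carrier A) (cdist A)"

locale cstar_algebra = abelian_group A for A :: "('a, 'm) cstar_scheme" (structure) +
  assumes mult_closed: "\<And>x y. \<lbrakk>x \<in> carrier A; y \<in> carrier A\<rbrakk> \<Longrightarrow> x \<otimes> y \<in> carrier A"
    and mult_assoc: "\<And>x y z. \<lbrakk>x \<in> carrier A; y \<in> carrier A; z \<in> carrier A\<rbrakk>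
                       \<Longrightarrow> (x \<otimes> y) \<otimes> z = x \<otimes> (y \<otimes> z)"
    and distrib_right: "\<And>x y z. \<lbrakk>x \<in> carrier A; y \<in> carrier A; z \<in> carrier A\<rbrakk>
                       \<Longrightarrow> (x \<oplus> y) \<otimes> z = x \<otimes> z \<oplus> y \<otimes> z"
    and distrib_left: "\<And>x y z. \<lbrakk>x \<in> carrier A; y \<in> carrier A; z \<in> carrier A\<rbrakk>
                       \<Longrightarrow> z \<otimes> (x \<oplus> y) = z \<otimes> x \<oplus> z \<otimes> y"
    and smult_closed: "\<And>a x. x \<in> carrier A \<Longrightarrow> a \<odot> x \<in> carrier A"
    and smult_add_left: "\<And>a b x. x \<in> carrier A \<Longrightarrow> (a + b) \<odot> x = a \<odot> x \<oplus> b \<odot> x"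
    and smult_add_right: "\<And>a x y. \<lbrakk>x \<in> carrier A; y \<in> carrier A\<rbrakk>
                       \<Longrightarrow> a \<odot> (x \<oplus> y) = a \<odot> x \<oplus> a \<odot> y"
    and smult_smult: "\<And>a b x. x \<in> carrier A \<Longrightarrow> a \<odot> (b \<odot> x) = (a * b) \<odot> x"
    and smult_one: "\<And>x. x \<in> carrier A \<Longrightarrow> 1 \<odot> x = x"
    and smult_mult_left: "\<And>a x y. \<lbrakk>x \<in> carrier A; y \<in> carrier A\<rbrakk>
                       \<Longrightarrow> (a \<odot> x) \<otimes> y = a \<odot> (x \<otimes> y)"
    and smult_mult_right: "\<And>a x y. \<lbrakk>x \<in> carrier A; y \<in> carrier A\<rbrakk>
                       \<Longrightarrow> x \<otimes> (a \<odot> y) = a \<odot> (x \<otimes> y)"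
    and adj_closed: "\<And>x. x \<in> carrier A \<Longrightarrow> adj A x \<in> carrier A"
    and adj_adj: "\<And>x. x \<in> carrier A \<Longrightarrow> adj A (adj A x) = x"
    and adj_add: "\<And>x y. \<lbrakk>x \<in> carrier A; y \<in> carrier A\<rbrakk> \<Longrightarrow> adj A (x \<oplus> y) = adj A x \<oplus> adj A y"
    and adj_smult: "\<And>a x. x \<in> carrier A \<Longrightarrow> adj A (a \<odot> x) = cnj a \<odot> adj A x"
    and adj_mult: "\<And>x y. \<lbrakk>x \<in> carrier A; y \<in> carrier A\<rbrakk> \<Longrightarrow> adj A (x \<otimes> y) = adj A y \<otimes> adj A x"
    and nrm_nonneg: "\<And>x. x \<in> carrier A \<Longrightarrow> 0 \<le> nrm A x"
    and nrm_eq_0: "\<And>x. x \<in> carrier A \<Longrightarrow> nrm A x = 0 \<longleftrightarrow> x = \<zero>"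
    and nrm_triangle: "\<And>x y. \<lbrakk>x \<in> carrier A; y \<in> carrier A\<rbrakk> \<Longrightarrow> nrm A (x \<oplus> y) \<le> nrm A x + nrm A y"
    and nrm_smult: "\<And>a x. x \<in> carrier A \<Longrightarrow> nrm A (a \<odot> x) = cmod a * nrm A x"
    and nrm_mult: "\<And>x y. \<lbrakk>x \<in> carrier A; y \<in> carrier A\<rbrakk> \<Longrightarrow> nrm A (x \<otimes> y) \<le> nrm A x * nrm A y"
    and cstar_identity: "\<And>x. x \<in> carrier A \<Longrightarrow> nrm A (adj A x \<otimes> x) = (nrm A x)\<^sup>2"
    and complete: "Metric_space.mcomplete (carrier A) (cdist A)"
begin

lemma smult_zero_left: "x \<in> carrier A \<Longrightarrow> 0 \<odot> x = \<zero>"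
  using smult_add_left[of x 0 0] smult_closed[of x 0] by (simp add: add.r_cancel_one')

lemma smult_minus_one: "x \<in> carrier A \<Longrightarrow> (-1) \<odot> x = \<ominus> x"
  using smult_add_left[of x "-1" 1] smult_closed[of x "-1"]
  by (simp add: smult_zero_left smult_one minus_equality)

lemma nrm_minus: "x \<in> carrier A \<Longrightarrow> nrm A (\<ominus> x) = nrm A x"
  using nrm_smult[of x "-1"] by (simp add: smult_minus_one)

sublocale metric: Metric_space "carrier A" "cdist A"
proof
  fix x y
  show "0 \<le> cdist A x y" by (simp add: cdist_def nrm_nonneg)
  show "cdist A x y = cdist A y x"
  proof (cases "x \<in> carrier A \<and> y \<in> carrier A")
    case True
    then have "y \<ominus> x = \<ominus> (x \<ominus> y)" by (simp add: minus_eq minus_add a_comm)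
    with True show ?thesis by (simp add: cdist_def nrm_minus)
  qed (auto simp: cdist_def)
next
  fix x y assume "x \<in> carrier A" "y \<in> carrier A"
  moreover from this have "x \<ominus> y = \<zero> \<longleftrightarrow> x = y"
    by (metis minus_eq minus_equality minus_minus a_inv_closed r_neg)
  ultimately show "cdist A x y = 0 \<longleftrightarrow> x = y"
    by (simp add: cdist_def nrm_eq_0)
next
  fix x y z assume xyz: "x \<in> carrier A" "y \<in> carrier A" "z \<in> carrier A"
  then have "x \<ominus> z = (x \<ominus> y) \<oplus> (y \<ominus> z)"
    by (simp add: minus_eq a_assoc r_neg2 r_neg1)
  with xyz nrm_triangle[of "x \<ominus> y" "y \<ominus> z"] show "cdist A x z \<le> cdist A x y + cdist A y z"
    by (simp add: cdist_def)
qed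

end

definition star_hom :: "('a, 'm) cstar_scheme \<Rightarrow> ('b, 'n) cstar_scheme \<Rightarrow> ('a \<Rightarrow> 'b) set" where
  "star_hom A B = {\<phi> \<in> carrier A \<rightarrow> carrier B.
     (\<forall>x \<in> carrier A. \<forall>y \<in> carrier A. \<phi> (x \<oplus>\<^bsub>A\<^esub> y) = \<phi> x \<oplus>\<^bsub>B\<^esub> \<phi> y) \<and>
     (\<forall>x \<in> carrier A. \<forall>y \<in> carrier A. \<phi> (x \<otimes>\<^bsub>A\<^esub> y) = \<phi> x \<otimes>\<^bsub>B\<^esub> \<phi> y) \<and>
     (\<forall>a. \<forall>x \<in> carrier A. \<phi> (a \<odot>\<^bsub>A\<^esub> x) = a \<odot>\<^bsub>B\<^esub> \<phi> x) \<and>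
     (\<forall>x \<in> carrier A. \<phi> (adj A x) = adj B (\<phi> x))}"

text \<open>Extensionality makes an automorphism determined by its values on the carrier.\<close>

definition star_aut :: "('a, 'm) cstar_scheme \<Rightarrow> ('a \<Rightarrow> 'a) set" where
  "star_aut A = {\<phi> \<in> star_hom A A. bij_betw \<phi> (carrier A) (carrier A) \<and> \<phi> \<in> extensional (carrier A)}"

definition closed_star_subalgebra :: "('a, 'm) cstar_scheme \<Rightarrow> 'a set \<Rightarrow> bool" where
  "closed_star_subalgebra A D \<longleftrightarrow> D \<subseteq> carrier A \<and> \<zero>\<^bsub>A\<^esub> \<in> D \<and>
     (\<forall>x \<in> D. \<forall>y \<in> D. x \<oplus>\<^bsub>A\<^esub> y \<in> D \<and> x \<otimes>\<^bsub>A\<^esub> y \<in> D) \<and>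
     (\<forall>a. \<forall>x \<in> D. a \<odot>\<^bsub>A\<^esub> x \<in> D) \<and> (\<forall>x \<in> D. adj A x \<in> D) \<and>
     closedin (ctopology A) D"

definition closed_ideal :: "('a, 'm) cstar_scheme \<Rightarrow> 'a set \<Rightarrow> bool" where
  "closed_ideal A I \<longleftrightarrow> I \<subseteq> carrier A \<and> \<zero>\<^bsub>A\<^esub> \<in> I \<and>
     (\<forall>x \<in> I. \<forall>y \<in> I. x \<oplus>\<^bsub>A\<^esub> y \<in> I) \<and> (\<forall>a. \<forall>x \<in> I. a \<odot>\<^bsub>A\<^esub> x \<in> I) \<and>
     (\<forall>x \<in> I. \<forall>y \<in> carrier A. x \<otimes>\<^bsub>A\<^esub> y \<in> I \<and> y \<otimes>\<^bsub>A\<^esub> x \<in> I) \<and>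
     closedin (ctopology A) I"

definition internal_direct_sum :: "('a, 'm) cstar_scheme \<Rightarrow> 'a set \<Rightarrow> 'a set \<Rightarrow> bool" where
  "internal_direct_sum C A B \<longleftrightarrow> A <+>\<^bsub>C\<^esub> B = carrier C \<and> A \<inter> B = {\<zero>\<^bsub>C\<^esub>}"


section \<open>The C*-algebra of a higher-rank graph\<close>

text \<open>
  The sum in the last clause is over a finite set when \<open>\<Lambda>\<close> is row-finite; \<open>finsum\<close> over an
  infinite set would be zero.
\<close>

definition ck_family ::
    "('l, 'k::finite) kgraph_data \<Rightarrow> ('a, 'm) cstar_scheme \<Rightarrow> ('l \<Rightarrow> 'a) \<Rightarrow> bool" where
  "ck_family \<Lambda> A S \<longleftrightarrow> S \<in> mor \<Lambda> \<rightarrow> carrier A \<and>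
     (\<forall>l \<in> mor \<Lambda>. S l \<otimes>\<^bsub>A\<^esub> adj A (S l) \<otimes>\<^bsub>A\<^esub> S l = S l) \<and>
     (\<forall>v \<in> vertices \<Lambda>. \<forall>w \<in> vertices \<Lambda>. S v \<otimes>\<^bsub>A\<^esub> S w = (if v = w then S v else \<zero>\<^bsub>A\<^esub>)) \<and>
     (\<forall>l \<in> mor \<Lambda>. \<forall>\<mu> \<in> mor \<Lambda>. src \<Lambda> l = rng \<Lambda> \<mu> \<longrightarrow> S l \<otimes>\<^bsub>A\<^esub> S \<mu> = S (cmp \<Lambda> l \<mu>)) \<and>
     (\<forall>l \<in> mor \<Lambda>. adj A (S l) \<otimes>\<^bsub>A\<^esub> S l = S (src \<Lambda> l)) \<and>
     (\<forall>v \<in> vertices \<Lambda>. \<forall>n. S v =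
        finsum A (\<lambda>l. S l \<otimes>\<^bsub>A\<^esub> adj A (S l)) (range_in \<Lambda> v (paths_le \<Lambda> n)))"

text \<open>
  \<open>(C, S)\<close> is a model of the universal C*-algebra of \<open>\<Lambda>\<close>; it is unique up to isomorphism
  intertwining the generators. HOL cannot quantify over all types inside a definition, so the test
  algebras \<open>B\<close> have their carriers in the type \<open>nat \<Rightarrow> real\<close>. This loses nothing: the closed
  *-subalgebra generated by a (countable) family satisfying the relations is separable, and a
  separable metric space with dense sequence \<open>a\<close> injects into that type by
  \<open>x \<mapsto> (\<lambda>n. dist x (a n))\<close>. Hence the universal property for these \<open>B\<close> implies it for
  C*-algebras over arbitrary types.
\<close>

definition graph_cstar_algebra ::
    "('l, 'k::finite) kgraph_data \<Rightarrow> ('a, 'm) cstar_scheme \<Rightarrow> ('l \<Rightarrow> 'a) \<Rightarrow> bool" where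
  "graph_cstar_algebra \<Lambda> C S \<longleftrightarrow> cstar_algebra C \<and> ck_family \<Lambda> C S \<and>
     (\<forall>D. closed_star_subalgebra C D \<and> S ` mor \<Lambda> \<subseteq> D \<longrightarrow> D = carrier C) \<and>
     (\<forall>(B :: (nat \<Rightarrow> real) cstar) T. cstar_algebra B \<and> ck_family \<Lambda> B T \<longrightarrow>
        (\<exists>\<pi> \<in> star_hom C B. \<forall>l \<in> mor \<Lambda>. \<pi> (S l) = T l))"

definition torus :: "(complex ^ 'k::finite) set" where
  "torus = {t. \<forall>i. cmod (t $ i) = 1}"

definition torus_power :: "complex ^ 'k::finite \<Rightarrow> nat ^ 'k \<Rightarrow> complex" where
  "torus_power t m = (\<Prod>i\<in>UNIV. t $ i ^ (m $ i))"

definition gauge_action ::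
    "('l, 'k::finite) kgraph_data \<Rightarrow> ('a, 'm) cstar_scheme \<Rightarrow> ('l \<Rightarrow> 'a) \<Rightarrow> complex ^ 'k \<Rightarrow> 'a \<Rightarrow> 'a" where
  "gauge_action \<Lambda> C S t = (THE \<phi>. \<phi> \<in> star_aut C \<and>
     (\<forall>l \<in> mor \<Lambda>. \<phi> (S l) = torus_power t (deg \<Lambda> l) \<odot>\<^bsub>C\<^esub> S l))"

definition gauge_invariant ::
    "('l, 'k::finite) kgraph_data \<Rightarrow> ('a, 'm) cstar_scheme \<Rightarrow> ('l \<Rightarrow> 'a) \<Rightarrow> 'a set \<Rightarrow> bool" where
  "gauge_invariant \<Lambda> C S I \<longleftrightarrow> (\<forall>t \<in> torus. gauge_action \<Lambda> C S t ` I \<subseteq> I)"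

end

theory Submission
  imports Defs
begin

text \<open>
  If \<open>C = A \<oplus> B\<close>, the projection \<open>\<pi>\<close> onto \<open>A\<close> is a *-homomorphism. For a vertex \<open>v\<close> the projection
  \<open>a = \<pi> (s\<^sub>v)\<close> is fixed by the gauge action: each \<open>\<gamma>\<^sub>t a\<close> is a projection below \<open>s\<^sub>v = \<gamma>\<^sub>t s\<^sub>v\<close>, hence
  commutes with \<open>a\<close>, and commuting projections at distance less than one agree. By strong continuity
  this applies to \<open>t\<close> close to \<open>1\<close>, and every \<open>t\<close> is a power of such an element. As
  \<open>\<pi> (s\<^sub>\<lambda>) = s\<^sub>\<lambda> \<pi> (s\<^sub>v)\<close> with \<open>v\<close> the source of \<open>\<lambda>\<close>, the homomorphisms \<open>\<gamma>\<^sub>t \<circ> \<pi>\<close> and \<open>\<pi> \<circ> \<gamma>\<^sub>t\<close> agree on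
  generators, so \<open>\<gamma>\<^sub>t\<close> maps \<open>A\<close> into \<open>A\<close>.

  Closedness of the sets on which *-homomorphisms agree or converge needs that *-homomorphisms are
  contractive. No spectral theory is used for this: a self-adjoint \<open>h\<close> with norm less than one is
  the real part of the unitary \<open>h + \<i> sqrt (1 - h\<^sup>2)\<close>, and so is its image.
\<close>

section \<open>Limits in C*-algebras\<close>

context cstar_algebra
begin

section \<open>Algebraic identities without a unit\<close>

lemma r_null: "x \<in> carrier A \<Longrightarrow> x \<otimes> \<zero> = \<zero>"
  using distrib_left[of \<zero> \<zero> x] by (simp add: mult_closed)

lemma l_null: "x \<in> carrier A \<Longrightarrow> \<zero> \<otimes> x = \<zero>"
  using distrib_right[of \<zero> \<zero> x] by (simp add: mult_closed)

lemma smult_zero_right: "a \<odot> \<zero> = \<zero>"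
  using smult_add_right[of \<zero> \<zero> a] by (simp add: smult_closed)

lemma smult_minus: "x \<in> carrier A \<Longrightarrow> a \<odot> (\<ominus> x) = \<ominus> (a \<odot> x)"
  using smult_add_right[of x "\<ominus> x" a]
  by (metis a_comm a_inv_closed minus_equality r_neg smult_closed smult_zero_right)

lemma mult_minus_right: "x \<in> carrier A \<Longrightarrow> y \<in> carrier A \<Longrightarrow> x \<otimes> (\<ominus> y) = \<ominus> (x \<otimes> y)"
  by (metis a_inv_closed mult_closed smult_minus_one smult_mult_right)

lemma mult_minus_left: "x \<in> carrier A \<Longrightarrow> y \<in> carrier A \<Longrightarrow> (\<ominus> x) \<otimes> y = \<ominus> (x \<otimes> y)"
  by (metis a_inv_closed mult_closed smult_minus_one smult_mult_left)

lemma adj_zero: "adj A \<zero> = \<zero>"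
  using adj_add[of \<zero> \<zero>] by (simp add: adj_closed)

lemma adj_minus: "x \<in> carrier A \<Longrightarrow> adj A (\<ominus> x) = \<ominus> (adj A x)"
  using adj_smult[of x "-1"] by (simp add: smult_minus_one adj_closed)

lemma nrm_zero: "nrm A \<zero> = 0"
  by (simp add: nrm_eq_0)

lemma nrm_adj: assumes x: "x \<in> carrier A" shows "nrm A (adj A x) = nrm A x"
proof -
  have le: "nrm A y \<le> nrm A (adj A y)" if y: "y \<in> carrier A" for y
  proof (cases "nrm A y = 0")
    case False
    have "nrm A y * nrm A y \<le> nrm A (adj A y) * nrm A y"
      using cstar_identity[OF y] nrm_mult[OF adj_closed[OF y] y] by (simp add: power2_eq_square)
    then show ?thesis using False nrm_nonneg[OF y] by simp
  qed (simp add: nrm_nonneg adj_closed y)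
  show ?thesis using le[OF x] le[OF adj_closed[OF x]] by (simp add: adj_adj x)
qed

lemma nrm_minus_triangle:
  "\<lbrakk>x \<in> carrier A; y \<in> carrier A\<rbrakk> \<Longrightarrow> nrm A (x \<ominus> y) \<le> nrm A x + nrm A y"
  using nrm_triangle[of x "\<ominus> y"] by (simp add: minus_eq nrm_minus)

lemma uminus_zero: "\<ominus> \<zero> = \<zero>"
  by (rule minus_equality) simp_all

text \<open>Sorting a sum with \<open>a_ac\<close> may leave a summand and its negative separated by
  one other term. These rules cancel across that gap, as \<open>r_neg1\<close> and
  \<open>r_neg2\<close> do for neighbours.\<close>

lemma neg_cancel:
  assumes "x \<in> carrier A" "y \<in> carrier A"
  shows "x \<oplus> (y \<oplus> \<ominus> x) = y" and "\<ominus> x \<oplus> (y \<oplus> x) = y"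
    and "z \<in> carrier A \<Longrightarrow> x \<oplus> (y \<oplus> (\<ominus> x \<oplus> z)) = y \<oplus> z"
    and "z \<in> carrier A \<Longrightarrow> \<ominus> x \<oplus> (y \<oplus> (x \<oplus> z)) = y \<oplus> z"
  using assms by (metis a_inv_closed a_lcomm r_neg r_zero, metis a_inv_closed a_lcomm l_neg r_zero,
      metis a_closed a_inv_closed a_lcomm r_neg2, metis a_closed a_inv_closed a_lcomm r_neg1)

lemmas add_cancel = a_ac r_neg l_neg r_neg1 r_neg2 neg_cancel

lemmas alg_simps = mult_closed smult_closed adj_closed distrib_left distrib_right mult_assoc
  smult_add_left smult_add_right smult_smult smult_one smult_mult_left smult_mult_right adj_add
  adj_mult adj_smult adj_adj minus_eq minus_add smult_minus mult_minus_left mult_minus_right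
  adj_minus r_null l_null smult_zero_left smult_zero_right adj_zero

section \<open>Sequential limits and continuity of the operations\<close>

lemma limitinD:
  assumes "limitin (ctopology A) f x sequentially"
  shows "(\<lambda>n. nrm A (f n \<ominus> x)) \<longlonglongrightarrow> 0"
proof -
  have x: "x \<in> carrier A" and ev: "\<forall>\<^sub>F n in sequentially. f n \<in> carrier A"
    and lim: "(\<lambda>n. cdist A (f n) x) \<longlonglongrightarrow> 0"
    using assms by (auto simp: metric.limitin_metric_dist_null)
  have "\<forall>\<^sub>F n in sequentially. cdist A (f n) x = nrm A (f n \<ominus> x)"
    using ev by eventually_elim (simp add: cdist_def x)
  with lim show ?thesis by (simp add: tendsto_cong)
qed

lemma limitinI:
  assumes x: "x \<in> carrier A" and f: "\<And>n. f n \<in> carrier A"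
    and e: "e \<longlonglongrightarrow> 0" and le: "\<And>n. nrm A (f n \<ominus> x) \<le> e n"
  shows "limitin (ctopology A) f x sequentially"
proof -
  have "(\<lambda>n. nrm A (f n \<ominus> x)) \<longlonglongrightarrow> 0"
    by (rule real_tendsto_sandwich[OF _ _ tendsto_const e]) (auto simp: nrm_nonneg x f le)
  then show ?thesis using x f by (simp add: metric.limitin_metric_dist_null cdist_def)
qed

lemma limitin_add:
  assumes "limitin (ctopology A) f x sequentially" "limitin (ctopology A) g y sequentially"
    and f: "\<And>n. f n \<in> carrier A" and g: "\<And>n. g n \<in> carrier A"
  shows "limitin (ctopology A) (\<lambda>n. f n \<oplus> g n) (x \<oplus> y) sequentially"
proof -
  have x: "x \<in> carrier A" and y: "y \<in> carrier A" using assms(1,2) metric.limitin_mspace by blast+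
  show ?thesis
  proof (rule limitinI)
    show "(\<lambda>n. nrm A (f n \<ominus> x) + nrm A (g n \<ominus> y)) \<longlonglongrightarrow> 0"
      by (rule tendsto_eq_intros limitinD assms)+ simp
    fix n
    have "f n \<oplus> g n \<ominus> (x \<oplus> y) = (f n \<ominus> x) \<oplus> (g n \<ominus> y)"
      using x y f[of n] g[of n] by (simp add: minus_eq minus_add a_ac)
    then show "nrm A (f n \<oplus> g n \<ominus> (x \<oplus> y)) \<le> nrm A (f n \<ominus> x) + nrm A (g n \<ominus> y)"
      using x y f[of n] g[of n] nrm_triangle by simp
  qed (use x y f g in auto)
qed

text \<open>With u and v the errors of the two factors, the error of the product is u v + x v + u y.
  In this form no bound on a convergent sequence has to be established first.\<close>

lemma limitin_mult:
  assumes "limitin (ctopology A) f x sequentially" "limitin (ctopology A) g y sequentially"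
    and f: "\<And>n. f n \<in> carrier A" and g: "\<And>n. g n \<in> carrier A"
  shows "limitin (ctopology A) (\<lambda>n. f n \<otimes> g n) (x \<otimes> y) sequentially"
proof -
  have x: "x \<in> carrier A" and y: "y \<in> carrier A" using assms(1,2) metric.limitin_mspace by blast+
  show ?thesis
  proof (rule limitinI)
    show "(\<lambda>n. nrm A (f n \<ominus> x) * nrm A (g n \<ominus> y) +
        (nrm A x * nrm A (g n \<ominus> y) + nrm A (f n \<ominus> x) * nrm A y)) \<longlonglongrightarrow> 0"
      by (rule tendsto_eq_intros limitinD assms refl)+ simp
    fix n
    define u v where "u = f n \<ominus> x" and "v = g n \<ominus> y"
    have uv: "u \<in> carrier A" "v \<in> carrier A" "f n = u \<oplus> x" "g n = v \<oplus> y"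
      using x y f[of n] g[of n] by (auto simp: u_def v_def minus_eq a_assoc l_neg)
    have eq: "f n \<otimes> g n \<ominus> x \<otimes> y = u \<otimes> v \<oplus> (x \<otimes> v \<oplus> u \<otimes> y)"
      using x y uv by (simp add: alg_simps add_cancel)
    show "nrm A (f n \<otimes> g n \<ominus> x \<otimes> y) \<le> nrm A (f n \<ominus> x) * nrm A (g n \<ominus> y) +
        (nrm A x * nrm A (g n \<ominus> y) + nrm A (f n \<ominus> x) * nrm A y)"
      unfolding eq u_def[symmetric] v_def[symmetric]
      using x y uv(1,2) nrm_triangle[of "u \<otimes> v" "x \<otimes> v \<oplus> u \<otimes> y"] nrm_triangle[of "x \<otimes> v" "u \<otimes> y"]
        nrm_mult[of u v] nrm_mult[of x v] nrm_mult[of u y]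
      by (simp add: mult_closed)
  qed (use x y f g mult_closed in auto)
qed

lemma limitin_smult:
  assumes "limitin (ctopology A) f x sequentially" and a: "a \<longlonglongrightarrow> l"
    and f: "\<And>n. f n \<in> carrier A"
  shows "limitin (ctopology A) (\<lambda>n. a n \<odot> f n) (l \<odot> x) sequentially"
proof -
  have x: "x \<in> carrier A" using assms(1) metric.limitin_mspace by blast
  have a0: "(\<lambda>n. cmod (a n - l)) \<longlonglongrightarrow> 0"
    using a by (simp add: LIM_zero tendsto_norm_zero)
  show ?thesis
  proof (rule limitinI)
    show "(\<lambda>n. cmod (a n) * nrm A (f n \<ominus> x) + cmod (a n - l) * nrm A x) \<longlonglongrightarrow> 0"
      by (rule tendsto_eq_intros limitinD assms a0 refl)+ simp
    fix n
    define u where "u = f n \<ominus> x"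
    have u: "u \<in> carrier A" "f n = u \<oplus> x"
      using x f[of n] by (auto simp: u_def minus_eq a_assoc l_neg)
    have "a n \<odot> x = (a n - l) \<odot> x \<oplus> l \<odot> x"
      using x by (simp flip: smult_add_left)
    then have eq: "a n \<odot> f n \<ominus> l \<odot> x = a n \<odot> u \<oplus> (a n - l) \<odot> x"
      using x u by (simp add: smult_add_right smult_closed minus_eq add_cancel)
    show "nrm A (a n \<odot> f n \<ominus> l \<odot> x) \<le> cmod (a n) * nrm A (f n \<ominus> x) + cmod (a n - l) * nrm A x"
      unfolding eq u_def[symmetric]
      using x u(1) nrm_triangle[of "a n \<odot> u" "(a n - l) \<odot> x"]
      by (simp add: smult_closed nrm_smult)
  qed (use x f smult_closed in auto)
qed

lemma limitin_adj:
  assumes "limitin (ctopology A) f x sequentially" and f: "\<And>n. f n \<in> carrier A"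
  shows "limitin (ctopology A) (\<lambda>n. adj A (f n)) (adj A x) sequentially"
proof -
  have x: "x \<in> carrier A" using assms(1) metric.limitin_mspace by blast
  show ?thesis
  proof (rule limitinI[OF _ _ limitinD[OF assms(1)]])
    fix n
    have "adj A (f n) \<ominus> adj A x = adj A (f n \<ominus> x)"
      using x f[of n] by (simp add: minus_eq adj_add adj_minus adj_closed)
    then show "nrm A (adj A (f n) \<ominus> adj A x) \<le> nrm A (f n \<ominus> x)"
      using x f[of n] by (simp add: nrm_adj)
  qed (use x f adj_closed in auto)
qed

text \<open>Formally \<open>g = 1 - sqrt (1 - h\<^sup>2)\<close>, obtained as the fixed point of a contraction.\<close>

lemma sqrt_complement_exists:
  assumes h: "h \<in> carrier A" "adj A h = h" and lt: "nrm A h < 1"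
  shows "\<exists>g \<in> carrier A. adj A g = g \<and> h \<otimes> g = g \<otimes> h \<and> g \<oplus> g = h \<otimes> h \<oplus> g \<otimes> g"
proof -
  \<comment> \<open>Halving 2 g = h^2 + g^2 turns the wanted relation into g = \<open>F g\<close>.
    On the self-adjoint elements that commute with \<open>h\<close> and have norm at most that of
    \<open>h\<close>, the map \<open>F\<close> contracts with constant
    \<open>nrm A h\<close>.\<close>
  define F where "F = (\<lambda>g. (1/2) \<odot> (h \<otimes> h \<oplus> g \<otimes> g))"
  define K where "K = {g \<in> carrier A. nrm A g \<le> nrm A h \<and> adj A g = g \<and> h \<otimes> g = g \<otimes> h}"
  let ?r = "nrm A h"
  have r0: "0 \<le> ?r" using h nrm_nonneg by auto
  have KC: "K \<subseteq> carrier A" by (auto simp: K_def)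
  have FK: "F g \<in> K" if "g \<in> K" for g
  proof -
    have g: "g \<in> carrier A" "nrm A g \<le> ?r" "adj A g = g" "h \<otimes> g = g \<otimes> h"
      using that by (auto simp: K_def)
    have "nrm A (F g) \<le> 1/2 * (nrm A (h \<otimes> h) + nrm A (g \<otimes> g))"
      using g h nrm_triangle[of "h \<otimes> h" "g \<otimes> g"] by (simp add: F_def nrm_smult mult_closed norm_divide)
    also have "\<dots> \<le> 1/2 * (?r * ?r + ?r * ?r)"
      using nrm_mult[OF h(1) h(1)] nrm_mult[OF g(1) g(1)] g r0 nrm_nonneg[OF g(1)]
        mult_mono[of "nrm A g" ?r "nrm A g" ?r] by simp
    also have "\<dots> \<le> ?r" using lt r0 by (simp add: mult_left_le)
    finally have 1: "nrm A (F g) \<le> ?r" .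
    have "h \<otimes> (g \<otimes> g) = g \<otimes> (g \<otimes> h)" using g h by (metis mult_assoc)
    then show ?thesis using 1 g h by (auto simp: K_def F_def alg_simps)
  qed
  have contr: "nrm A (F x \<ominus> F y) \<le> ?r * nrm A (x \<ominus> y)" if "x \<in> K" "y \<in> K" for x y
  proof -
    have xy: "x \<in> carrier A" "y \<in> carrier A" "nrm A x \<le> ?r" "nrm A y \<le> ?r"
      using that by (auto simp: K_def)
    define d where "d = x \<ominus> y"
    have d: "d \<in> carrier A" "x = d \<oplus> y"
      using xy by (auto simp: d_def minus_eq a_assoc l_neg)
    \<comment> \<open>The noncommutative difference of squares: x^2 - y^2 = x (x - y) + (x - y)
      y.\<close>
    have "F x \<ominus> F y = (1/2) \<odot> (x \<otimes> d \<oplus> d \<otimes> y)"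
      using xy h d by (simp add: F_def alg_simps add_cancel)
    then have "nrm A (F x \<ominus> F y) \<le> 1/2 * (nrm A (x \<otimes> d) + nrm A (d \<otimes> y))"
      using xy d nrm_triangle[of "x \<otimes> d" "d \<otimes> y"] by (simp add: nrm_smult mult_closed norm_divide)
    also have "\<dots> \<le> 1/2 * (?r * nrm A d + nrm A d * ?r)"
      using nrm_mult[OF xy(1) d(1)] nrm_mult[OF d(1) xy(2)] xy nrm_nonneg[OF d(1)]
        mult_right_mono[of "nrm A x" ?r "nrm A d"] mult_left_mono[of "nrm A y" ?r "nrm A d"]
      by (simp add: mult.commute[of _ "nrm A d"])
    finally show ?thesis by (simp add: d_def)
  qed
  define g where "g n = (F ^^ n) \<zero>" for n
  have gK: "g n \<in> K" for n
  proof (induction n)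
    case 0
    show ?case by (simp add: g_def K_def nrm_zero adj_zero r_null l_null h r0)
  qed (simp add: g_def FK)
  then have gC: "g n \<in> carrier A" for n using KC by auto
  \<comment> \<open>Uniform in \<open>k\<close>, so this bounds the distance from \<open>g n\<close>
    to all later iterates. At n = 0 that distance is at most \<open>nrm A h\<close>, hence below
    2.\<close>
  have gap: "nrm A (g (n + k) \<ominus> g n) \<le> 2 * ?r ^ n" for n k
  proof (induction n)
    case 0
    have "nrm A (g k \<ominus> g 0) \<le> ?r + 0"
      using nrm_minus_triangle[OF gC gC, of k 0] gK[of k] by (simp add: K_def g_def nrm_zero)
    then show ?case using lt by simp
  next
    case (Suc n)
    have "nrm A (g (Suc n + k) \<ominus> g (Suc n)) \<le> ?r * nrm A (g (n + k) \<ominus> g n)"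
      using contr[OF gK gK] by (simp add: g_def)
    also have "\<dots> \<le> ?r * (2 * ?r ^ n)" using Suc r0 by (rule mult_left_mono)
    finally show ?case by simp
  qed
  have "metric.MCauchy g"
    unfolding metric.MCauchy_def
  proof (intro conjI strip)
    fix e :: real assume "e > 0"
    \<comment> \<open>Two distances to \<open>g N\<close>, each at most \<open>2 * ?r ^ N\<close>,
      add up to the constant 4.\<close>
    have "(\<lambda>n. 4 * ?r ^ n) \<longlonglongrightarrow> 0"
      by (rule tendsto_eq_intros LIMSEQ_realpow_zero r0 lt refl)+ simp
    then obtain N where "4 * ?r ^ N < e"
      using order_tendstoD(2)[OF _ \<open>e > 0\<close>] eventually_happens' sequentially_bot by blast
    moreover have "cdist A (g m) (g n) \<le> 4 * ?r ^ N" if "N \<le> m" "N \<le> n" for m n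
      using metric.triangle[OF gC[of m] gC[of N] gC[of n]] metric.commute[of "g N" "g n"]
        gap[of N "m - N"] gap[of N "n - N"] that by (simp add: cdist_def gC)
    ultimately show "\<exists>N. \<forall>n n'. N \<le> n \<longrightarrow> N \<le> n' \<longrightarrow> cdist A (g n) (g n') < e"
      by (meson le_less_trans)
  qed (use gC in auto)
  then obtain l where l: "limitin (ctopology A) g l sequentially"
    using complete by (auto simp: metric.mcomplete_def)
  then have lC: "l \<in> carrier A" using metric.limitin_mspace by auto
  have unique: "x = y" if "limitin (ctopology A) f x sequentially" "limitin (ctopology A) f y sequentially"
    for f x y using that metric.limitin_metric_unique trivial_limit_sequentially by blast
  have "adj A l = l"
    using unique[OF limitin_adj[OF l gC]] l gK by (simp add: K_def)
  moreover have const: "limitin (ctopology A) (\<lambda>n. x) x sequentially" if "x \<in> carrier A" for x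
    using that by simp
  have "h \<otimes> l = l \<otimes> h"
    using unique[OF limitin_mult[OF const l] ] limitin_mult[OF l const[OF h(1)] gC] gK gC h
    by (simp add: K_def)
  moreover have "limitin (ctopology A) (\<lambda>n. F (g n)) (F l) sequentially"
    unfolding F_def using gC h
    by (intro limitin_smult limitin_add limitin_mult const l) (auto simp: mult_closed)
  \<comment> \<open>Here \<open>F (g n)\<close> is \<open>g (Suc n)\<close>, and a shifted sequence
    has the same limit. Continuity of \<open>F\<close> then makes \<open>l\<close> a fixed
    point.\<close>
  moreover have "limitin (ctopology A) (\<lambda>n. F (g n)) l sequentially"
    using l limitin_sequentially_offset[of _ g l 1] by (simp add: g_def)
  ultimately have "l = F l" using unique by blast
  then have "l \<oplus> l = F l \<oplus> F l" by simp
  also have "\<dots> = h \<otimes> h \<oplus> l \<otimes> l"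
    using lC h by (simp add: F_def mult_closed smult_one flip: smult_add_left)
  finally show ?thesis using \<open>adj A l = l\<close> \<open>h \<otimes> l = l \<otimes> h\<close> lC by blast
qed

end

section \<open>*-homomorphisms are contractive\<close>

context cstar_algebra
begin

text \<open>By \<open>comm\<close> the two cross terms of adj (x + c y) times (x + c y) add up to (c
  + cnj c) times adj y x, which vanishes for imaginary c. The C*-identity turns what remains into
  the norm formula.\<close>

lemma nrm_add_imaginary:
  assumes x: "x \<in> carrier A" and y: "y \<in> carrier A"
    and comm: "adj A x \<otimes> y = adj A y \<otimes> x" and c: "c = \<i> \<or> c = - \<i>"
  shows "(nrm A (x \<oplus> c \<odot> y))\<^sup>2 = nrm A (adj A x \<otimes> x \<oplus> adj A y \<otimes> y)"
proof -
  have [simp]: "cnj c * c = 1" "c * cnj c = 1" and cnj: "cnj c = - c" using c by auto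
  have "adj A (x \<oplus> c \<odot> y) \<otimes> (x \<oplus> c \<odot> y) =
      adj A x \<otimes> x \<oplus> adj A y \<otimes> y \<oplus> (c \<odot> (adj A y \<otimes> x) \<oplus> (cnj c) \<odot> (adj A y \<otimes> x))"
    using x y comm by (simp add: alg_simps a_ac)
  also have "\<dots> = adj A x \<otimes> x \<oplus> adj A y \<otimes> y"
    using x y by (simp add: cnj mult_closed adj_closed smult_zero_left flip: smult_add_left)
  finally show ?thesis
    using cstar_identity[of "x \<oplus> c \<odot> y"] x y by (simp add: smult_closed)
qed

text \<open>The hypotheses say that \<open>h + \<i>(1 - g)\<close> is unitary, and \<open>h\<close> is its real part.\<close>

lemma nrm_le_1_if_sqrt_complement:
  assumes h: "h \<in> carrier A" "adj A h = h" and g: "g \<in> carrier A" "adj A g = g"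
    and hg: "h \<otimes> g = g \<otimes> h" and eq: "g \<oplus> g = h \<otimes> h \<oplus> g \<otimes> g"
  shows "nrm A h \<le> 1"
proof -
  \<comment> \<open>Put u = h + \<i>(1 - g). The elements d + \<i> c and d - \<i> c are h u and h
    times the adjoint of u; they lie in the algebra even if 1 does not. As u is unitary, both have
    the norm of h. Their sum is 2 h^2, so the square of that norm is at most the norm
    itself.\<close>
  define d where "d = h \<otimes> h"
  define c where "c = h \<ominus> h \<otimes> g"
  have dc: "d \<in> carrier A" "c \<in> carrier A" using h g by (auto simp: d_def c_def mult_closed)
  have gh: "g \<otimes> h = h \<otimes> g" "x \<in> carrier A \<Longrightarrow> g \<otimes> (h \<otimes> x) = h \<otimes> (g \<otimes> x)" for x
    using hg h g by (simp, metis mult_assoc)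
  have adj: "adj A d = d" "adj A c = c"
    using h g by (simp_all add: c_def d_def alg_simps gh)
  \<comment> \<open>Multiplying \<open>eq\<close> by h^2 gives 2 p = h^4 + q, and the square of h (1
    - g) is h^2 - 2 p + q. Together they say h^4 + c^2 = h^2, which is h^2 times the relation h^2 +
    (1 - g)^2 = 1.\<close>
  define p where "p = d \<otimes> g"
  define q where "q = p \<otimes> g"
  have pq: "p \<in> carrier A" "q \<in> carrier A" using dc g by (auto simp: p_def q_def mult_closed)
  have "p \<oplus> p = d \<otimes> d \<oplus> q"
    using arg_cong[OF eq, of "\<lambda>x. d \<otimes> x"] dc h g
    by (simp add: distrib_left mult_closed mult_assoc p_def q_def flip: d_def)
  moreover have "c \<otimes> c = d \<oplus> q \<ominus> (p \<oplus> p)"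
    using h g by (simp add: c_def d_def p_def q_def alg_simps gh a_ac)
  ultimately have "d \<otimes> d \<oplus> c \<otimes> c = d"
    using dc pq by (simp add: mult_closed minus_eq minus_add add_cancel)
  then have sum: "adj A d \<otimes> d \<oplus> adj A c \<otimes> c = h \<otimes> h"
    unfolding adj by (simp add: d_def)
  have "adj A d \<otimes> c = adj A c \<otimes> d"
    unfolding adj using h g by (simp add: c_def d_def alg_simps gh)
  then have n: "nrm A (d \<oplus> \<i> \<odot> c) = nrm A h" "nrm A (d \<oplus> (- \<i>) \<odot> c) = nrm A h"
    using nrm_add_imaginary[OF dc, of \<i>] nrm_add_imaginary[OF dc, of "- \<i>"] cstar_identity[OF h(1)] dc
    by (auto simp: sum h nrm_nonneg smult_closed)
  have "(d \<oplus> \<i> \<odot> c) \<oplus> (d \<oplus> (- \<i>) \<odot> c) = (d \<oplus> d) \<oplus> (\<i> \<odot> c \<oplus> (- \<i>) \<odot> c)"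
    using dc by (simp add: smult_closed a_ac)
  also have "\<dots> = 2 \<odot> d"
    using dc smult_add_left[of d 1 1] by (simp add: smult_one smult_zero_left flip: smult_add_left)
  finally have "2 * nrm A d \<le> nrm A h + nrm A h"
    using nrm_triangle[of "d \<oplus> \<i> \<odot> c" "d \<oplus> (- \<i>) \<odot> c"] dc by (simp add: n smult_closed nrm_smult)
  then have "nrm A h * nrm A h \<le> nrm A h * 1"
    using cstar_identity[OF h(1)] h by (simp add: d_def power2_eq_square)
  then show ?thesis
    using nrm_nonneg[OF h(1)] by (cases "nrm A h = 0") auto
qed

end

section \<open>*-homomorphisms between two C*-algebras\<close>

lemma star_homD:
  assumes "\<phi> \<in> star_hom A B"
  shows "x \<in> carrier A \<Longrightarrow> \<phi> x \<in> carrier B"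
    and "\<lbrakk>x \<in> carrier A; y \<in> carrier A\<rbrakk> \<Longrightarrow> \<phi> (x \<oplus>\<^bsub>A\<^esub> y) = \<phi> x \<oplus>\<^bsub>B\<^esub> \<phi> y"
    and "\<lbrakk>x \<in> carrier A; y \<in> carrier A\<rbrakk> \<Longrightarrow> \<phi> (x \<otimes>\<^bsub>A\<^esub> y) = \<phi> x \<otimes>\<^bsub>B\<^esub> \<phi> y"
    and "x \<in> carrier A \<Longrightarrow> \<phi> (a \<odot>\<^bsub>A\<^esub> x) = a \<odot>\<^bsub>B\<^esub> \<phi> x"
    and "x \<in> carrier A \<Longrightarrow> \<phi> (adj A x) = adj B (\<phi> x)"
  using assms by (auto simp: star_hom_def)

lemma star_hom_comp:
  assumes "\<phi> \<in> star_hom A B" "\<psi> \<in> star_hom B D"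
  shows "(\<lambda>x. \<psi> (\<phi> x)) \<in> star_hom A D"
  using assms by (auto simp: star_hom_def Pi_iff)

locale cstar_pair = A: cstar_algebra A + B: cstar_algebra B
  for A :: "('a, 'm) cstar_scheme" and B :: "('b, 'n) cstar_scheme"
begin

lemma star_hom_zero: "\<phi> \<in> star_hom A B \<Longrightarrow> \<phi> \<zero>\<^bsub>A\<^esub> = \<zero>\<^bsub>B\<^esub>"
  using star_homD(4)[of \<phi> A B "\<zero>\<^bsub>A\<^esub>" 0] star_homD(1)[of \<phi> A B "\<zero>\<^bsub>A\<^esub>"]
  by (simp add: A.smult_zero_left B.smult_zero_left)

lemma star_hom_uminus: "\<phi> \<in> star_hom A B \<Longrightarrow> x \<in> carrier A \<Longrightarrow> \<phi> (\<ominus>\<^bsub>A\<^esub> x) = \<ominus>\<^bsub>B\<^esub> \<phi> x"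
  using star_homD(4)[of \<phi> A B x "-1"] star_homD(1)[of \<phi> A B x]
  by (simp add: A.smult_minus_one B.smult_minus_one)

lemma star_hom_minus:
  "\<lbrakk>\<phi> \<in> star_hom A B; x \<in> carrier A; y \<in> carrier A\<rbrakk> \<Longrightarrow> \<phi> (x \<ominus>\<^bsub>A\<^esub> y) = \<phi> x \<ominus>\<^bsub>B\<^esub> \<phi> y"
  by (simp add: A.minus_eq B.minus_eq star_homD star_hom_uminus)

text \<open>The relations between \<open>h\<close> and its square-root element are algebraic, so
  \<phi> carries them to B, where they force norm at most one. Scaling gives the bound for every
  self-adjoint element, and the C*-identity passes from adj x times x to x.\<close>

theorem star_hom_contractive:
  assumes \<phi>: "\<phi> \<in> star_hom A B" and x: "x \<in> carrier A"
  shows "nrm B (\<phi> x) \<le> nrm A x"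
proof -
  have selfadj: "nrm B (\<phi> h) \<le> nrm A h" if h: "h \<in> carrier A" "adj A h = h" for h
  proof (rule dense_ge)
    \<comment> \<open>The square-root element is available only for norm strictly below one, hence
      the scaling by an arbitrary \<open>r\<close> above the norm of \<open>h\<close>.\<close>
    fix r assume r: "nrm A h < r"
    then have r0: "0 < r" using A.nrm_nonneg[OF h(1)] by simp
    define k where "k = complex_of_real (1 / r) \<odot>\<^bsub>A\<^esub> h"
    have k: "k \<in> carrier A" "adj A k = k" "nrm A k < 1"
      using h r r0 by (simp_all add: k_def A.smult_closed A.adj_smult A.nrm_smult norm_divide)
    then obtain g where "g \<in> carrier A" "adj A g = g" "k \<otimes>\<^bsub>A\<^esub> g = g \<otimes>\<^bsub>A\<^esub> k"
      "g \<oplus>\<^bsub>A\<^esub> g = k \<otimes>\<^bsub>A\<^esub> k \<oplus>\<^bsub>A\<^esub> g \<otimes>\<^bsub>A\<^esub> g"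
      using A.sqrt_complement_exists by blast
    then have "nrm B (\<phi> k) \<le> 1"
      using k by (intro B.nrm_le_1_if_sqrt_complement[of _ "\<phi> g"])
        (auto simp: star_homD[OF \<phi>] A.mult_closed simp flip: star_homD(2,3,5)[OF \<phi>])
    then show "nrm B (\<phi> h) \<le> r"
      using h r0 by (simp add: k_def star_homD[OF \<phi>] B.nrm_smult norm_divide divide_simps)
  qed
  have "(nrm B (\<phi> x))\<^sup>2 = nrm B (\<phi> (adj A x \<otimes>\<^bsub>A\<^esub> x))"
    using x by (simp add: star_homD[OF \<phi>] A.adj_closed B.cstar_identity)
  also have "\<dots> \<le> (nrm A x)\<^sup>2"
    using x selfadj[of "adj A x \<otimes>\<^bsub>A\<^esub> x"]
    by (simp add: A.adj_closed A.mult_closed A.adj_mult A.adj_adj A.cstar_identity)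
  finally show ?thesis
    using A.nrm_nonneg[OF x] by (rule power2_le_imp_le)
qed

text \<open>Reduces pointwise convergence of *-homomorphisms to a check on generators. The algebraic
  closure properties are continuity of the operations; topological closedness is an e/3 argument,
  valid because all the maps are contractive.\<close>

lemma closed_star_subalgebra_pointwise_limit:
  assumes \<phi>: "\<And>n. \<phi> n \<in> star_hom A B" and \<psi>: "\<psi> \<in> star_hom A B"
  shows "closed_star_subalgebra A
    {x \<in> carrier A. limitin (ctopology B) (\<lambda>n. \<phi> n x) (\<psi> x) sequentially}" (is "closed_star_subalgebra A ?D")
  unfolding closed_star_subalgebra_def
proof (intro conjI ballI allI)
  show "\<zero>\<^bsub>A\<^esub> \<in> ?D" by (simp add: star_hom_zero \<phi> \<psi>)
  show "x \<oplus>\<^bsub>A\<^esub> y \<in> ?D" "x \<otimes>\<^bsub>A\<^esub> y \<in> ?D" if "x \<in> ?D" "y \<in> ?D" for x y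
    using that by (auto simp: star_homD[OF \<phi>] star_homD[OF \<psi>] A.mult_closed
        intro!: B.limitin_add B.limitin_mult)
  show "a \<odot>\<^bsub>A\<^esub> x \<in> ?D" if "x \<in> ?D" for a x
    using that by (auto simp: star_homD[OF \<phi>] star_homD[OF \<psi>] A.smult_closed intro!: B.limitin_smult)
  show "adj A x \<in> ?D" if "x \<in> ?D" for x
    using that by (auto simp: star_homD[OF \<phi>] star_homD[OF \<psi>] A.adj_closed intro!: B.limitin_adj)
  show "closedin (ctopology A) ?D"
    unfolding A.metric.metric_closedin_iff_sequentially_closed
  proof (intro conjI allI impI; (elim conjE)?)
    fix f x assume f: "range f \<subseteq> ?D" and lim: "limitin (ctopology A) f x sequentially"
    have x: "x \<in> carrier A" using lim A.metric.limitin_mspace by blast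
    have fC: "f m \<in> carrier A" for m using f by auto
    have "(\<lambda>n. nrm B (\<phi> n x \<ominus>\<^bsub>B\<^esub> \<psi> x)) \<longlonglongrightarrow> 0"
    proof (rule LIMSEQ_I)
      fix e :: real assume e: "e > 0"
      obtain m where m: "nrm A (f m \<ominus>\<^bsub>A\<^esub> x) < e / 3"
        using order_tendstoD(2)[OF A.limitinD[OF lim], of "e/3"] e
          eventually_happens' sequentially_bot by fastforce
      obtain N where N: "\<And>n. n \<ge> N \<Longrightarrow> nrm B (\<phi> n (f m) \<ominus>\<^bsub>B\<^esub> \<psi> (f m)) < e / 3"
        using order_tendstoD(2)[OF B.limitinD, of "\<lambda>n. \<phi> n (f m)" "\<psi> (f m)" "e/3"] e f
        by (auto simp: eventually_sequentially)
      have "nrm B (\<phi> n x \<ominus>\<^bsub>B\<^esub> \<psi> x) < e" if "n \<ge> N" for n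
      proof -
        define y where "y = f m \<ominus>\<^bsub>A\<^esub> x"
        have y: "y \<in> carrier A" using x fC by (simp add: y_def)
        have c: "\<phi> n z \<in> carrier B" "\<psi> z \<in> carrier B" if "z \<in> carrier A" for z
          using that by (auto intro: star_homD(1) \<phi> \<psi>)
        \<comment> \<open>The e/3 split. The last two terms are controlled by contractivity, since
          \<open>y\<close> is the small difference between \<open>f m\<close> and
          \<open>x\<close>.\<close>
        have "\<phi> n x \<ominus>\<^bsub>B\<^esub> \<psi> x = (\<phi> n (f m) \<ominus>\<^bsub>B\<^esub> \<psi> (f m)) \<oplus>\<^bsub>B\<^esub> (\<psi> y \<ominus>\<^bsub>B\<^esub> \<phi> n y)"
          using x fC c by (simp add: y_def star_hom_minus \<phi> \<psi> B.minus_eq B.minus_add B.add_cancel)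
        then have "nrm B (\<phi> n x \<ominus>\<^bsub>B\<^esub> \<psi> x)
            \<le> nrm B (\<phi> n (f m) \<ominus>\<^bsub>B\<^esub> \<psi> (f m)) + (nrm B (\<psi> y) + nrm B (\<phi> n y))"
          using B.nrm_triangle[of "\<phi> n (f m) \<ominus>\<^bsub>B\<^esub> \<psi> (f m)" "\<psi> y \<ominus>\<^bsub>B\<^esub> \<phi> n y"]
            B.nrm_minus_triangle[of "\<psi> y" "\<phi> n y"] fC y c by fastforce
        then show ?thesis
          using N[OF that] m star_hom_contractive[OF \<phi> y, of n] star_hom_contractive[OF \<psi> y]
          by (simp add: y_def)
      qed
      then show "\<exists>N. \<forall>n\<ge>N. norm (nrm B (\<phi> n x \<ominus>\<^bsub>B\<^esub> \<psi> x) - 0) < e"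
        using x by (auto simp: B.nrm_nonneg star_homD(1)[OF \<phi>] star_homD(1)[OF \<psi>])
    qed
    then show "x \<in> ?D"
      using x by (auto intro: B.limitinI star_homD(1) \<phi> \<psi>)
  qed auto
qed auto

text \<open>The case of a constant sequence in the preceding lemma: by uniqueness of limits it
  converges to \<psi> x only if \<phi> x = \<psi> x.\<close>

lemma closed_star_subalgebra_equaliser:
  assumes "\<phi> \<in> star_hom A B" and "\<psi> \<in> star_hom A B"
  shows "closed_star_subalgebra A {x \<in> carrier A. \<phi> x = \<psi> x}"
proof -
  have "limitin (ctopology B) (\<lambda>n. \<phi> x) (\<psi> x) sequentially \<longleftrightarrow> \<phi> x = \<psi> x" if "x \<in> carrier A" for x
    using that assms star_homD(1)[of _ A B] B.metric.limitin_metric_unique[of "\<lambda>n. \<phi> x" "\<phi> x" sequentially "\<psi> x"]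
    by auto
  then have "{x \<in> carrier A. \<phi> x = \<psi> x} =
      {x \<in> carrier A. limitin (ctopology B) (\<lambda>n. \<phi> x) (\<psi> x) sequentially}" by blast
  then show ?thesis
    using closed_star_subalgebra_pointwise_limit[of "\<lambda>n. \<phi>" \<psi>] assms by simp
qed

end

section \<open>Separability and transport of structure\<close>

text \<open>Close the generators under the operations, with scalars from a countable dense set
  \<open>K\<close> only, so that the result \<open>Q\<close> stays countable. The closure of
  \<open>Q\<close> is a closed *-subalgebra containing the generators, hence everything.\<close>

lemma (in cstar_algebra) countable_dense_if_countably_generated:
  assumes X: "countable X" "X \<subseteq> carrier A"
    and gen: "\<And>D. closed_star_subalgebra A D \<Longrightarrow> X \<subseteq> D \<Longrightarrow> D = carrier A"
  obtains Q where "countable Q" "Q \<subseteq> carrier A" "ctopology A closure_of Q = carrier A"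
proof -
  obtain K :: "complex set" where K: "countable K" "closure K = UNIV"
    using separable[of "UNIV :: complex set"] by (metis UNIV_eq_I subsetD iso_tuple_UNIV_I)
  define F where "F Y = Y \<union> (\<lambda>(x, y). x \<oplus> y) ` (Y \<times> Y) \<union> (\<lambda>(x, y). x \<otimes> y) ` (Y \<times> Y) \<union>
      (\<lambda>(a, x). a \<odot> x) ` (K \<times> Y) \<union> adj A ` Y" for Y
  define G where "G n = (F ^^ n) (insert \<zero> X)" for n
  define Q where "Q = (\<Union>n. G n)"
  have "countable (G n) \<and> G n \<subseteq> carrier A" for n
  proof (induction n)
    case 0
    show ?case using X by (simp add: G_def)
  next
    case (Suc n)
    have "G (Suc n) = F (G n)" by (simp add: G_def)
    with Suc K show ?case
      by (auto simp: F_def mult_closed smult_closed adj_closed subset_iff)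
  qed
  then have Q: "countable Q" "Q \<subseteq> carrier A" by (auto simp: Q_def)
  have mono: "G m \<subseteq> G n" if "m \<le> n" for m n
    using that by (induction rule: dec_induct) (auto simp: G_def F_def)
  have GQ: "F (G n) \<subseteq> Q" for n
  proof -
    have "F (G n) = G (Suc n)" by (simp add: G_def)
    then show ?thesis by (auto simp: Q_def)
  qed
  \<comment> \<open>The stages increase, so two elements of \<open>Q\<close> appear in a common
    stage, and the next stage contains their sum and product.\<close>
  have two: "\<exists>n. x \<in> G n \<and> y \<in> G n" if xy: "x \<in> Q" "y \<in> Q" for x y
  proof -
    obtain m n where "x \<in> G m" "y \<in> G n" using xy by (auto simp: Q_def)
    then have "x \<in> G (max m n)" "y \<in> G (max m n)"
      using mono[of m "max m n"] mono[of n "max m n"] by auto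
    then show ?thesis by blast
  qed
  have Qop: "x \<oplus> y \<in> Q" "x \<otimes> y \<in> Q" "adj A x \<in> Q" if "x \<in> Q" "y \<in> Q" for x y
    using two[OF that] GQ by (force simp: F_def)+
  have Qsmult: "a \<odot> x \<in> Q" if "x \<in> Q" "a \<in> K" for x a
    using two[OF that(1) that(1)] GQ that(2) by (force simp: F_def)
  have XQ: "insert \<zero> X \<subseteq> Q"
  proof -
    have "insert \<zero> X = G 0" by (simp add: G_def)
    then show ?thesis unfolding Q_def by blast
  qed
  have D: "x \<in> ctopology A closure_of Q \<longleftrightarrow> (\<exists>f. range f \<subseteq> Q \<and> limitin (ctopology A) f x sequentially)" for x
    using Q(2) by (auto simp: metric.closure_of_sequentially dest: metric.limitin_mspace)
  have "closed_star_subalgebra A (ctopology A closure_of Q)"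
    unfolding closed_star_subalgebra_def
  proof (intro conjI ballI allI)
    show "ctopology A closure_of Q \<subseteq> carrier A"
      using closure_of_subset_topspace[of "ctopology A" Q] by simp
    show "\<zero> \<in> ctopology A closure_of Q"
      using XQ Q(2) closure_of_subset[of Q "ctopology A"] by auto
    show "closedin (ctopology A) (ctopology A closure_of Q)" by simp
  next
    fix x y assume "x \<in> ctopology A closure_of Q" "y \<in> ctopology A closure_of Q"
    then obtain f g where fg: "range f \<subseteq> Q" "limitin (ctopology A) f x sequentially"
      "range g \<subseteq> Q" "limitin (ctopology A) g y sequentially" by (auto simp: D)
    then have n: "f n \<in> Q" "g n \<in> Q" "f n \<in> carrier A" "g n \<in> carrier A" for n
      using Q(2) by auto
    have "limitin (ctopology A) (\<lambda>n. f n \<oplus> g n) (x \<oplus> y) sequentially"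
      "limitin (ctopology A) (\<lambda>n. f n \<otimes> g n) (x \<otimes> y) sequentially"
      using limitin_add[OF fg(2,4)] limitin_mult[OF fg(2,4)] n by auto
    moreover have "range (\<lambda>n. f n \<oplus> g n) \<subseteq> Q" "range (\<lambda>n. f n \<otimes> g n) \<subseteq> Q"
      using n Qop by auto
    ultimately show "x \<oplus> y \<in> ctopology A closure_of Q" "x \<otimes> y \<in> ctopology A closure_of Q"
      unfolding D by blast+
  next
    fix x assume "x \<in> ctopology A closure_of Q"
    then obtain f where f: "range f \<subseteq> Q" "limitin (ctopology A) f x sequentially" by (auto simp: D)
    then have fQ: "f n \<in> Q" for n by auto
    then have fC: "f n \<in> carrier A" for n using Q(2) by auto
    show "adj A x \<in> ctopology A closure_of Q"
      unfolding D
    proof (intro exI conjI)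
      show "limitin (ctopology A) (\<lambda>n. adj A (f n)) (adj A x) sequentially"
        by (rule limitin_adj[OF f(2) fC])
    qed (use fQ Qop in blast)
    fix a
    \<comment> \<open>\<open>Q\<close> admits only scalars from \<open>K\<close>; an arbitrary
      \<open>a\<close> is approximated by such scalars simultaneously with \<open>x\<close>.\<close>
    obtain k where k: "\<And>n. k n \<in> K" "k \<longlonglongrightarrow> a"
      using K(2) closure_sequential[of a K] by auto
    show "a \<odot> x \<in> ctopology A closure_of Q"
      unfolding D
    proof (intro exI conjI)
      show "limitin (ctopology A) (\<lambda>n. k n \<odot> f n) (a \<odot> x) sequentially"
        by (rule limitin_smult[OF f(2) k(2) fC])
    qed (use fQ Qsmult k in auto)
  qed
  moreover have "X \<subseteq> ctopology A closure_of Q"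
    using XQ Q(2) closure_of_subset[of Q "ctopology A"] by auto
  ultimately have "ctopology A closure_of Q = carrier A" by (rule gen)
  with Q that show thesis by blast
qed

text \<open>Distances to a dense sequence determine a point: if they agree for x and y, a member of
  the sequence close to x is equally close to y.\<close>

lemma (in Metric_space) separable_imp_inj_real_sequence:
  assumes Q: "countable Q" "mtopology closure_of Q = M"
  obtains f :: "'a \<Rightarrow> nat \<Rightarrow> real" where "inj_on f M"
proof
  show "inj_on (\<lambda>x n. d x (from_nat_into Q n)) M"
  proof (rule inj_onI)
    fix x y assume xy: "x \<in> M" "y \<in> M"
      and eq: "(\<lambda>n. d x (from_nat_into Q n)) = (\<lambda>n. d y (from_nat_into Q n))"
    have "d x y \<le> 0 + e" if "e > 0" for e
    proof -
      have "x \<in> mtopology closure_of Q" using xy Q by simp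
      then obtain q where q: "q \<in> Q" "q \<in> M" "d x q < e / 2"
        using half_gt_zero[OF \<open>0 < e\<close>] unfolding metric_closure_of by fastforce
      then have "d x q = d y q"
        using eq Q(1) from_nat_into_to_nat_on by metis
      then show ?thesis using triangle[of x q y] q xy commute[of q y] by simp
    qed
    then have "d x y \<le> 0" by (rule field_le_epsilon)
    then show "x = y" using xy nonneg[of x y] zero[of x y] by simp
  qed
qed

text \<open>
  The universal property only covers carriers in \<open>nat \<Rightarrow> real\<close>. A copy of the graph algebra itself
  on such a carrier makes it applicable to families in the graph algebra.
\<close>

definition transport :: "('a \<Rightarrow> 'b) \<Rightarrow> 'a cstar \<Rightarrow> 'b cstar" where
  "transport f A = (let g = inv_into (carrier A) f in
     \<lparr>carrier = f ` carrier A, mult = \<lambda>x y. f (g x \<otimes>\<^bsub>A\<^esub> g y), one = f \<one>\<^bsub>A\<^esub>,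
      zero = f \<zero>\<^bsub>A\<^esub>, add = \<lambda>x y. f (g x \<oplus>\<^bsub>A\<^esub> g y), smult = \<lambda>a x. f (a \<odot>\<^bsub>A\<^esub> g x),
      adj = \<lambda>x. f (adj A (g x)), nrm = \<lambda>x. nrm A (g x)\<rparr>)"

section \<open>Axioms of the transported algebra\<close>

context
  fixes A :: "'a cstar" and f :: "'a \<Rightarrow> 'b"
  assumes A: "cstar_algebra A" and f: "inj_on f (carrier A)"
begin

interpretation A: cstar_algebra A by (rule A)

lemma transport_simps:
  "carrier (transport f A) = f ` carrier A"
  "zero (transport f A) = f \<zero>\<^bsub>A\<^esub>"
  "\<lbrakk>x \<in> carrier A; y \<in> carrier A\<rbrakk> \<Longrightarrow> f x \<oplus>\<^bsub>transport f A\<^esub> f y = f (x \<oplus>\<^bsub>A\<^esub> y)"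
  "\<lbrakk>x \<in> carrier A; y \<in> carrier A\<rbrakk> \<Longrightarrow> f x \<otimes>\<^bsub>transport f A\<^esub> f y = f (x \<otimes>\<^bsub>A\<^esub> y)"
  "x \<in> carrier A \<Longrightarrow> a \<odot>\<^bsub>transport f A\<^esub> f x = f (a \<odot>\<^bsub>A\<^esub> x)"
  "x \<in> carrier A \<Longrightarrow> adj (transport f A) (f x) = f (adj A x)"
  "x \<in> carrier A \<Longrightarrow> nrm (transport f A) (f x) = nrm A x"
  using f by (simp_all add: transport_def Let_def)

lemma transport_abelian_group: "abelian_group (transport f A)"
proof (rule abelian_groupI)
  fix x assume "x \<in> carrier (transport f A)"
  then obtain y where "y \<in> carrier A" "x = f y" by (auto simp: transport_simps)
  then show "\<exists>z\<in>carrier (transport f A). z \<oplus>\<^bsub>transport f A\<^esub> x = \<zero>\<^bsub>transport f A\<^esub>"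
    by (intro bexI[of _ "f (\<ominus>\<^bsub>A\<^esub> y)"]) (auto simp: transport_simps A.l_neg)
qed (auto simp: transport_simps A.a_ac)

text \<open>Subtraction is not a field of the record but is defined through inverses in the additive
  group. It has to be computed in the copy before distances can be compared.\<close>

lemma transport_minus:
  assumes "x \<in> carrier A" "y \<in> carrier A"
  shows "f x \<ominus>\<^bsub>transport f A\<^esub> f y = f (x \<ominus>\<^bsub>A\<^esub> y)"
proof -
  interpret T: abelian_group "transport f A" by (rule transport_abelian_group)
  have "\<ominus>\<^bsub>transport f A\<^esub> f y = f (\<ominus>\<^bsub>A\<^esub> y)"
    using assms by (intro T.minus_equality) (auto simp: transport_simps A.l_neg)
  then show ?thesis
    using assms by (simp add: T.minus_eq A.minus_eq transport_simps)
qed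

lemma transport_cdist:
  "\<lbrakk>x \<in> carrier A; y \<in> carrier A\<rbrakk> \<Longrightarrow> cdist (transport f A) (f x) (f y) = cdist A x y"
  by (simp add: cdist_def transport_minus transport_simps)

text \<open>Completeness is itself an axiom of \<open>cstar_algebra\<close>, so the metric of the
  copy cannot be taken from that locale yet and its axioms are checked directly. As \<open>f\<close>
  is an isometry, Cauchy sequences pull back and their limits push forward.\<close>

lemma transport_mcomplete:
  "Metric_space.mcomplete (carrier (transport f A)) (cdist (transport f A))"
proof -
  interpret T: Metric_space "f ` carrier A" "cdist (transport f A)"
  proof
    show "0 \<le> cdist (transport f A) x y" for x y
      by (auto simp: cdist_def transport_simps transport_minus A.nrm_nonneg)
    show "cdist (transport f A) x y = cdist (transport f A) y x" for x y
    proof (cases "x \<in> f ` carrier A \<and> y \<in> f ` carrier A")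
      case True
      then show ?thesis using A.metric.commute by (auto simp: transport_cdist)
    qed (auto simp: cdist_def transport_simps)
  qed (use f A.metric.triangle in \<open>auto simp: transport_cdist inj_on_eq_iff\<close>)
  show ?thesis
    unfolding transport_simps T.mcomplete_def
  proof (intro allI impI)
    fix \<sigma> assume \<sigma>: "T.MCauchy \<sigma>"
    define \<tau> where "\<tau> n = inv_into (carrier A) f (\<sigma> n)" for n
    have \<tau>: "\<tau> n \<in> carrier A" "\<sigma> n = f (\<tau> n)" for n
      using \<sigma> by (auto simp: \<tau>_def T.MCauchy_def inv_into_into f_inv_into_f image_subset_iff)
    then have "A.metric.MCauchy \<tau>"
      using \<sigma> by (auto simp: T.MCauchy_def A.metric.MCauchy_def transport_cdist)
    then obtain l where "limitin (ctopology A) \<tau> l sequentially"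
      using A.complete by (auto simp: A.metric.mcomplete_def)
    then have "limitin T.mtopology \<sigma> (f l) sequentially"
      using \<tau> by (simp add: T.limitin_metric A.metric.limitin_metric transport_cdist)
    then show "\<exists>l. limitin T.mtopology \<sigma> l sequentially" ..
  qed
qed

lemma transport_cstar_algebra: "cstar_algebra (transport f A)"
proof -
  interpret T: abelian_group "transport f A" by (rule transport_abelian_group)
  show ?thesis
  proof unfold_locales
    show "nrm (transport f A) x = 0 \<longleftrightarrow> x = \<zero>\<^bsub>transport f A\<^esub>" if "x \<in> carrier (transport f A)" for x
      using that f by (auto simp: transport_simps A.nrm_eq_0 inj_on_eq_iff)
  qed (use transport_mcomplete in \<open>auto simp: transport_simps A.mult_closed A.smult_closed A.adj_closed
      A.mult_assoc A.distrib_left A.distrib_right A.smult_add_left A.smult_add_right A.smult_smult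
      A.smult_one A.smult_mult_left A.smult_mult_right A.adj_adj A.adj_add A.adj_smult A.adj_mult
      A.nrm_nonneg A.nrm_triangle A.nrm_smult A.nrm_mult A.cstar_identity\<close>)
qed

lemma transport_star_hom: "f \<in> star_hom A (transport f A)"
  by (auto simp: star_hom_def transport_simps)

lemma transport_inv_star_hom: "inv_into (carrier A) f \<in> star_hom (transport f A) A"
  using f by (auto simp: star_hom_def transport_simps A.mult_closed A.smult_closed A.adj_closed)

end

text \<open>Preservation of zero covers the empty sum and also infinite index sets, over which
  \<open>finsum\<close> is zero by convention.\<close>

lemma star_hom_finsum:
  assumes "abelian_monoid A" "abelian_monoid B" "\<phi> \<in> star_hom A B" "\<phi> \<zero>\<^bsub>A\<^esub> = \<zero>\<^bsub>B\<^esub>"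
    and "g \<in> X \<rightarrow> carrier A"
  shows "\<phi> (finsum A g X) = finsum B (\<lambda>x. \<phi> (g x)) X"
proof -
  interpret A: abelian_monoid A by fact
  interpret B: abelian_monoid B by fact
  note \<phi> = star_homD[OF assms(3)]
  show ?thesis
  proof (cases "finite X")
    case True
    then show ?thesis using \<open>g \<in> X \<rightarrow> carrier A\<close>
    proof (induction X)
      case (insert x X)
      then show ?case by (simp add: Pi_iff \<phi> A.finsum_closed)
    qed (simp add: assms(4))
  qed (simp add: A.finsum_infinite B.finsum_infinite assms(4))
qed

text \<open>All the relations are *-algebraic and so survive any *-homomorphism. This moves a family
  in the graph algebra to the copy on which the universal property can be tested.\<close>

lemma (in cstar_pair) star_hom_ck_family:
  assumes \<phi>: "\<phi> \<in> star_hom A B" and S: "ck_family \<Lambda> A S"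
  shows "ck_family \<Lambda> B (\<lambda>l. \<phi> (S l))"
proof -
  have S': "S l \<in> carrier A" "S l \<otimes>\<^bsub>A\<^esub> adj A (S l) \<in> carrier A" if "l \<in> mor \<Lambda>" for l
    using S that by (auto simp: ck_family_def Pi_iff intro!: A.mult_closed A.adj_closed)
  have "\<phi> (S l) \<otimes>\<^bsub>B\<^esub> adj B (\<phi> (S l)) = \<phi> (S l \<otimes>\<^bsub>A\<^esub> adj A (S l))" if "l \<in> mor \<Lambda>" for l
    using S' that by (simp add: star_homD[OF \<phi>] A.adj_closed)
  moreover have "\<phi> (S l) \<otimes>\<^bsub>B\<^esub> \<phi> (S m) = \<phi> (S l \<otimes>\<^bsub>A\<^esub> S m)" if "l \<in> mor \<Lambda>" "m \<in> mor \<Lambda>" for l m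
    using S' that by (simp add: star_homD[OF \<phi>] A.adj_closed)
  moreover have "adj B (\<phi> (S l)) \<otimes>\<^bsub>B\<^esub> \<phi> (S l) = \<phi> (adj A (S l) \<otimes>\<^bsub>A\<^esub> S l)" if "l \<in> mor \<Lambda>" for l
    using S' that by (simp add: star_homD[OF \<phi>] A.adj_closed)
  moreover have "\<phi> (S l \<otimes>\<^bsub>A\<^esub> adj A (S l)) \<otimes>\<^bsub>B\<^esub> \<phi> (S l) = \<phi> (S l \<otimes>\<^bsub>A\<^esub> adj A (S l) \<otimes>\<^bsub>A\<^esub> S l)"
    if "l \<in> mor \<Lambda>" for l
    using S' that by (simp add: star_homD[OF \<phi>])
  moreover have "finsum B (\<lambda>l. \<phi> (S l) \<otimes>\<^bsub>B\<^esub> adj B (\<phi> (S l))) (range_in \<Lambda> v (paths_le \<Lambda> n)) =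
      \<phi> (finsum A (\<lambda>l. S l \<otimes>\<^bsub>A\<^esub> adj A (S l)) (range_in \<Lambda> v (paths_le \<Lambda> n)))" for v n
  proof -
    have sub: "range_in \<Lambda> v (paths_le \<Lambda> n) \<subseteq> mor \<Lambda>" by (auto simp: range_in_def paths_le_def)
    have "\<phi> (finsum A (\<lambda>l. S l \<otimes>\<^bsub>A\<^esub> adj A (S l)) (range_in \<Lambda> v (paths_le \<Lambda> n))) =
        finsum B (\<lambda>l. \<phi> (S l \<otimes>\<^bsub>A\<^esub> adj A (S l))) (range_in \<Lambda> v (paths_le \<Lambda> n))"
      using sub S' by (intro star_hom_finsum A.abelian_monoid_axioms B.abelian_monoid_axioms \<phi>
          star_hom_zero) auto
    also have "\<dots> = finsum B (\<lambda>l. \<phi> (S l) \<otimes>\<^bsub>B\<^esub> adj B (\<phi> (S l))) (range_in \<Lambda> v (paths_le \<Lambda> n))"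
      using sub S' star_homD[OF \<phi>]
      by (intro B.finsum_cong') (auto simp: A.adj_closed B.mult_closed B.adj_closed subset_iff)
    finally show ?thesis ..
  qed
  moreover have "vertices \<Lambda> \<subseteq> mor \<Lambda>" by (auto simp: vertices_def paths_def)
  ultimately show ?thesis
    using S S' unfolding ck_family_def
    by (auto simp: star_homD(1)[OF \<phi>] star_hom_zero[OF \<phi>] subset_iff)
qed

section \<open>The gauge action\<close>

lemma torus_power_mult: "torus_power (\<chi> i. s $ i * t $ i) m = torus_power s m * torus_power t m"
  by (simp add: torus_power_def power_mult_distrib prod.distrib)

lemma torus_power_add: "torus_power t (m + n) = torus_power t m * torus_power t n"
  by (simp add: torus_power_def power_add prod.distrib)

lemma torus_power_zero: "torus_power t 0 = 1"
  by (simp add: torus_power_def)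

lemma cnj_mult_torus_power: "t \<in> torus \<Longrightarrow> cnj (torus_power t m) * torus_power t m = 1"
  by (simp add: torus_power_def torus_def flip: prod.distrib power_mult_distrib)
    (simp add: mult.commute[of "cnj _"] complex_norm_square[symmetric])

text \<open>The scalars have modulus one, so they cancel whenever a generator meets its own adjoint.
  They multiply correctly because the degree is a functor, and they are 1 on vertices.\<close>

lemma ck_family_torus_power:
  assumes \<Lambda>: "kgraph \<Lambda>" and C: "cstar_algebra C" and S: "ck_family \<Lambda> C S" and t: "t \<in> torus"
  shows "ck_family \<Lambda> C (\<lambda>l. torus_power t (deg \<Lambda> l) \<odot>\<^bsub>C\<^esub> S l)"
proof -
  interpret kgraph \<Lambda> by fact
  interpret C: cstar_algebra C by fact
  let ?T = "\<lambda>l. torus_power t (deg \<Lambda> l) \<odot>\<^bsub>C\<^esub> S l"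
  have SC: "S l \<in> carrier C" if "l \<in> mor \<Lambda>" for l
    using S that by (auto simp: ck_family_def)
  have vert: "v \<in> mor \<Lambda>" "deg \<Lambda> v = 0" if "v \<in> vertices \<Lambda>" for v
    using that by (auto simp: vertices_def paths_def)
  have vT: "?T v = S v" if "v \<in> vertices \<Lambda>" for v
    using vert[OF that] SC by (simp add: torus_power_zero C.smult_one)
  have TT: "adj C (?T l) \<otimes>\<^bsub>C\<^esub> ?T l = adj C (S l) \<otimes>\<^bsub>C\<^esub> S l"
    "?T l \<otimes>\<^bsub>C\<^esub> adj C (?T l) = S l \<otimes>\<^bsub>C\<^esub> adj C (S l)" if "l \<in> mor \<Lambda>" for l
    using SC[OF that] cnj_mult_torus_power[OF t, of "deg \<Lambda> l"]
    by (simp_all add: C.adj_smult C.smult_mult_left C.smult_mult_right C.smult_smult C.smult_closed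
        C.adj_closed C.mult_closed C.smult_one mult.commute)
  show ?thesis
    unfolding ck_family_def
  proof (intro conjI ballI allI impI)
    show "?T \<in> mor \<Lambda> \<rightarrow> carrier C" using SC C.smult_closed by auto
    fix l assume l: "l \<in> mor \<Lambda>"
    show "?T l \<otimes>\<^bsub>C\<^esub> adj C (?T l) \<otimes>\<^bsub>C\<^esub> ?T l = ?T l"
      unfolding TT(2)[OF l] using S l SC
      by (simp add: ck_family_def C.smult_mult_right C.mult_closed C.adj_closed)
    have "src \<Lambda> l \<in> vertices \<Lambda>"
      using l by (simp add: vertices_iff_identity src_mor rng_src)
    then show "adj C (?T l) \<otimes>\<^bsub>C\<^esub> ?T l = ?T (src \<Lambda> l)"
      using S l by (simp add: TT vT ck_family_def)
    fix m assume m: "m \<in> mor \<Lambda>" "src \<Lambda> l = rng \<Lambda> m"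
    then have "S l \<otimes>\<^bsub>C\<^esub> S m = S (cmp \<Lambda> l m)"
      using S l by (auto simp: ck_family_def)
    then show "?T l \<otimes>\<^bsub>C\<^esub> ?T m = ?T (cmp \<Lambda> l m)"
      using l m SC[OF l] SC[OF m(1)] SC[OF cmp_mor[OF l m]]
      by (simp add: deg_cmp torus_power_add C.smult_mult_left C.smult_mult_right
          C.smult_smult C.smult_closed mult.commute)
  next
    fix v w assume "v \<in> vertices \<Lambda>" "w \<in> vertices \<Lambda>"
    then show "?T v \<otimes>\<^bsub>C\<^esub> ?T w = (if v = w then ?T v else \<zero>\<^bsub>C\<^esub>)"
      using S by (simp only: vT ck_family_def)
  next
    fix v n assume v: "v \<in> vertices \<Lambda>"
    have sub: "range_in \<Lambda> v (paths_le \<Lambda> n) \<subseteq> mor \<Lambda>" by (auto simp: range_in_def paths_le_def)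
    have "finsum C (\<lambda>l. ?T l \<otimes>\<^bsub>C\<^esub> adj C (?T l)) (range_in \<Lambda> v (paths_le \<Lambda> n)) =
        finsum C (\<lambda>l. S l \<otimes>\<^bsub>C\<^esub> adj C (S l)) (range_in \<Lambda> v (paths_le \<Lambda> n))"
      using sub SC by (intro C.finsum_cong') (auto simp: TT C.mult_closed C.adj_closed subset_iff)
    also have "\<dots> = ?T v" using S v by (simp add: vT ck_family_def)
    finally show "?T v = finsum C (\<lambda>l. ?T l \<otimes>\<^bsub>C\<^esub> adj C (?T l)) (range_in \<Lambda> v (paths_le \<Lambda> n))" ..
  qed
qed

section \<open>Consequences of the universal property\<close>

locale graph_algebra = kgraph \<Lambda> + C: cstar_algebra C
  for \<Lambda> :: "('l, 'k::finite) kgraph_data" and C :: "'a cstar" +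
  fixes S :: "'l \<Rightarrow> 'a"
  assumes universal: "graph_cstar_algebra \<Lambda> C S"
begin

abbreviation (input) \<gamma> where "\<gamma> \<equiv> gauge_action \<Lambda> C S"

sublocale cstar_pair C C ..

lemma ck: "ck_family \<Lambda> C S"
  using universal by (simp add: graph_cstar_algebra_def)

lemma S_closed: "l \<in> mor \<Lambda> \<Longrightarrow> S l \<in> carrier C"
  using ck by (auto simp: ck_family_def)

lemma generated: "closed_star_subalgebra C D \<Longrightarrow> S ` mor \<Lambda> \<subseteq> D \<Longrightarrow> D = carrier C"
  using universal by (simp add: graph_cstar_algebra_def)

text \<open>The set where the two maps agree is a closed *-subalgebra containing the
  generators.\<close>

lemma star_hom_eqI:
  assumes "\<phi> \<in> star_hom C C" "\<psi> \<in> star_hom C C"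
    and "\<And>l. l \<in> mor \<Lambda> \<Longrightarrow> \<phi> (S l) = \<psi> (S l)" and "x \<in> carrier C"
  shows "\<phi> x = \<psi> x"
  using generated[OF closed_star_subalgebra_equaliser[OF assms(1,2)]] assms(3,4) S_closed by blast

text \<open>The algebra is separable, being countably generated, so it has a copy carried by real
  sequences. The family is pushed into the copy, the universal property is applied there, and the
  resulting map is composed with the inverse of \<open>f\<close>.\<close>

lemma star_hom_exists:
  assumes T: "ck_family \<Lambda> C T"
  shows "\<exists>\<phi> \<in> star_hom C C. \<forall>l \<in> mor \<Lambda>. \<phi> (S l) = T l"
proof -
  obtain Q where Q: "countable Q" "Q \<subseteq> carrier C" "ctopology C closure_of Q = carrier C"
  proof (rule C.countable_dense_if_countably_generated)
    show "countable (S ` mor \<Lambda>)" "S ` mor \<Lambda> \<subseteq> carrier C"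
      using countable_mor S_closed by auto
  qed (use generated in blast)+
  obtain f :: "'a \<Rightarrow> nat \<Rightarrow> real" where f: "inj_on f (carrier C)"
    using C.metric.separable_imp_inj_real_sequence[OF Q(1,3)] .
  note tr = C.cstar_algebra_axioms f
  interpret T: cstar_algebra "transport f C" by (rule transport_cstar_algebra[OF tr])
  interpret CT: cstar_pair C "transport f C" ..
  have "ck_family \<Lambda> (transport f C) (\<lambda>l. f (T l))"
    by (rule CT.star_hom_ck_family[OF transport_star_hom[OF tr] T])
  then obtain \<pi> where \<pi>: "\<pi> \<in> star_hom C (transport f C)" "\<And>l. l \<in> mor \<Lambda> \<Longrightarrow> \<pi> (S l) = f (T l)"
    using conjunct2[OF conjunct2[OF conjunct2[OF universal[unfolded graph_cstar_algebra_def]]]]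
      T.cstar_algebra_axioms by meson
  have "T l \<in> carrier C" if "l \<in> mor \<Lambda>" for l
    using T that by (auto simp: ck_family_def)
  then have "\<forall>l \<in> mor \<Lambda>. inv_into (carrier C) f (\<pi> (S l)) = T l"
    by (simp add: \<pi>(2) inv_into_f_f f)
  then show ?thesis
    by (rule bexI[OF _ star_hom_comp[OF \<pi>(1) transport_inv_star_hom[OF tr]]])
qed

text \<open>Makes the definite description in \<open>gauge_action\<close> meaningful. The
  endomorphism for the conjugate of \<open>t\<close> is inverse to the one for \<open>t\<close>,
  since both composites fix the generators.\<close>

lemma gauge_action_unique_existence:
  assumes t: "t \<in> torus"
  shows "\<exists>!\<phi>. \<phi> \<in> star_aut C \<and> (\<forall>l \<in> mor \<Lambda>. \<phi> (S l) = torus_power t (deg \<Lambda> l) \<odot>\<^bsub>C\<^esub> S l)"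
proof (rule ex_ex1I)
  have hom: "\<exists>\<phi> \<in> star_hom C C. \<forall>l \<in> mor \<Lambda>. \<phi> (S l) = torus_power t (deg \<Lambda> l) \<odot>\<^bsub>C\<^esub> S l"
    if "t \<in> torus" for t
    using that ck kgraph_axioms C.cstar_algebra_axioms by (intro star_hom_exists ck_family_torus_power)
  define u where "u = (\<chi> i. cnj (t $ i))"
  have u: "u \<in> torus" using t by (simp add: u_def torus_def)
  have ut: "torus_power u m * torus_power t m = 1" for m
    using cnj_mult_torus_power[OF t, of m] by (simp add: u_def torus_power_def)
  obtain \<phi> where \<phi>: "\<phi> \<in> star_hom C C" "\<And>l. l \<in> mor \<Lambda> \<Longrightarrow> \<phi> (S l) = torus_power t (deg \<Lambda> l) \<odot>\<^bsub>C\<^esub> S l"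
    using hom[OF t] by blast
  obtain \<psi> where \<psi>: "\<psi> \<in> star_hom C C" "\<And>l. l \<in> mor \<Lambda> \<Longrightarrow> \<psi> (S l) = torus_power u (deg \<Lambda> l) \<odot>\<^bsub>C\<^esub> S l"
    using hom[OF u] by blast
  have id: "(\<lambda>x. x) \<in> star_hom C C" by (simp add: star_hom_def)
  have "\<psi> (\<phi> x) = x" if "x \<in> carrier C" for x
    using star_hom_eqI[OF star_hom_comp[OF \<phi>(1) \<psi>(1)] id] that ut
    by (simp add: \<phi>(2) \<psi>(2) star_homD(4)[OF \<psi>(1)] S_closed C.smult_smult C.smult_one mult.commute)
  moreover have "\<phi> (\<psi> x) = x" if "x \<in> carrier C" for x
    using star_hom_eqI[OF star_hom_comp[OF \<psi>(1) \<phi>(1)] id] that ut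
    by (simp add: \<phi>(2) \<psi>(2) star_homD(4)[OF \<phi>(1)] S_closed C.smult_smult C.smult_one)
  ultimately have bij: "bij_betw \<phi> (carrier C) (carrier C)"
    using star_homD(1)[OF \<phi>(1)] star_homD(1)[OF \<psi>(1)] by (intro bij_betwI[of _ _ _ \<psi>]) auto
  \<comment> \<open>\<open>star_aut\<close> prescribes the value outside the carrier; uniqueness as
    a HOL function depends on this.\<close>
  have "restrict \<phi> (carrier C) \<in> star_aut C"
    using bij \<phi>(1) by (auto simp: star_aut_def star_hom_def bij_betw_restrict_eq
        C.mult_closed C.smult_closed C.adj_closed)
  then show "\<exists>\<phi>. \<phi> \<in> star_aut C \<and> (\<forall>l \<in> mor \<Lambda>. \<phi> (S l) = torus_power t (deg \<Lambda> l) \<odot>\<^bsub>C\<^esub> S l)"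
    using \<phi>(2) S_closed by (intro exI[of _ "restrict \<phi> (carrier C)"]) auto
next
  fix \<phi> \<psi>
  assume *: "\<phi> \<in> star_aut C \<and> (\<forall>l \<in> mor \<Lambda>. \<phi> (S l) = torus_power t (deg \<Lambda> l) \<odot>\<^bsub>C\<^esub> S l)"
    "\<psi> \<in> star_aut C \<and> (\<forall>l \<in> mor \<Lambda>. \<psi> (S l) = torus_power t (deg \<Lambda> l) \<odot>\<^bsub>C\<^esub> S l)"
  then have hom: "\<phi> \<in> star_hom C C" "\<psi> \<in> star_hom C C" by (auto simp: star_aut_def)
  have "\<phi> x = \<psi> x" if "x \<in> carrier C" for x
    using * by (intro star_hom_eqI[OF hom _ that]) simp
  moreover have "\<phi> \<in> extensional (carrier C)" "\<psi> \<in> extensional (carrier C)"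
    using * by (simp_all add: star_aut_def)
  ultimately show "\<phi> = \<psi>" by (rule extensionalityI[rotated 2])
qed

lemma
  assumes t: "t \<in> torus"
  shows gauge_action_star_hom: "\<gamma> t \<in> star_hom C C"
    and gauge_action_generator: "l \<in> mor \<Lambda> \<Longrightarrow> \<gamma> t (S l) = torus_power t (deg \<Lambda> l) \<odot>\<^bsub>C\<^esub> S l"
  using theI'[OF gauge_action_unique_existence[OF t]] by (auto simp: gauge_action_def star_aut_def)

lemma gauge_action_closed: "t \<in> torus \<Longrightarrow> x \<in> carrier C \<Longrightarrow> \<gamma> t x \<in> carrier C"
  by (rule star_homD(1)[OF gauge_action_star_hom])

lemma gauge_action_vertex: "t \<in> torus \<Longrightarrow> v \<in> vertices \<Lambda> \<Longrightarrow> \<gamma> t (S v) = S v"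
  by (simp add: vertices_def paths_def gauge_action_generator torus_power_zero C.smult_one S_closed)

lemma gauge_action_mult:
  assumes s: "s \<in> torus" and t: "t \<in> torus" and x: "x \<in> carrier C"
  shows "\<gamma> (\<chi> i. s $ i * t $ i) x = \<gamma> s (\<gamma> t x)"
proof (rule star_hom_eqI[OF _ star_hom_comp[OF gauge_action_star_hom[OF t] gauge_action_star_hom[OF s]] _ x])
  have st: "(\<chi> i. s $ i * t $ i) \<in> torus" using s t by (simp add: torus_def norm_mult)
  then show "\<gamma> (\<chi> i. s $ i * t $ i) \<in> star_hom C C" by (rule gauge_action_star_hom)
  fix l assume l: "l \<in> mor \<Lambda>"
  show "\<gamma> (\<chi> i. s $ i * t $ i) (S l) = \<gamma> s (\<gamma> t (S l))"
    using l by (simp add: gauge_action_generator s t st torus_power_mult S_closed C.smult_smult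
        star_homD(4)[OF gauge_action_star_hom[OF s]] mult.commute)
qed

text \<open>Strong continuity at the identity of the torus. On a generator it is convergence of the
  scalars to 1; the set of x for which it holds is a closed *-subalgebra.\<close>

lemma gauge_action_tendsto:
  assumes t: "\<And>n. t n \<in> torus" and lim: "t \<longlonglongrightarrow> (\<chi> i. 1)" and x: "x \<in> carrier C"
  shows "limitin (ctopology C) (\<lambda>n. \<gamma> (t n) x) x sequentially"
proof -
  have id: "(\<lambda>x. x) \<in> star_hom C C" by (simp add: star_hom_def)
  let ?D = "{x \<in> carrier C. limitin (ctopology C) (\<lambda>n. \<gamma> (t n) x) x sequentially}"
  have "(\<lambda>n. torus_power (t n) m) \<longlonglongrightarrow> 1" for m
  proof -
    have "(\<lambda>n. \<Prod>i\<in>UNIV. t n $ i ^ (m $ i)) \<longlonglongrightarrow> (\<Prod>i\<in>UNIV. (\<chi> i. 1) $ i ^ (m $ i))"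
      by (intro tendsto_prod tendsto_power tendsto_vec_nth lim)
    then show ?thesis by (simp add: torus_power_def)
  qed
  then have "limitin (ctopology C) (\<lambda>n. \<gamma> (t n) (S l)) (S l) sequentially" if l: "l \<in> mor \<Lambda>" for l
    using C.limitin_smult[of "\<lambda>n. S l" "S l" "\<lambda>n. torus_power (t n) (deg \<Lambda> l)" 1] S_closed[OF l]
    by (simp add: gauge_action_generator t l C.smult_one)
  then have "?D = carrier C"
    using S_closed closed_star_subalgebra_pointwise_limit[OF gauge_action_star_hom[OF t] id]
    by (intro generated) auto
  with x show ?thesis by blast
qed

end

section \<open>Direct summands\<close>

context cstar_algebra
begin

section \<open>Complementary ideals, their projections, and roots in the torus\<close>

lemma internal_direct_sum_commute:
  assumes "I \<subseteq> carrier A" "J \<subseteq> carrier A" "internal_direct_sum A I J"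
  shows "internal_direct_sum A J I"
proof -
  have "x \<oplus> y = y \<oplus> x" if "x \<in> I" "y \<in> J" for x y
    using that assms by (intro a_comm) auto
  then have "I <+>\<^bsub>A\<^esub> J = J <+>\<^bsub>A\<^esub> I"
    unfolding set_add_def' by auto metis+
  then show ?thesis
    using assms by (simp add: internal_direct_sum_def Int_commute)
qed

lemma closed_ideal_minus:
  assumes I: "closed_ideal A I" and "x \<in> I" "y \<in> I"
  shows "x \<ominus> y \<in> I"
proof -
  have "y \<in> carrier A" using assms by (auto simp: closed_ideal_def)
  then have "\<ominus> y = (-1) \<odot> y" by (simp add: smult_minus_one)
  then show ?thesis using assms unfolding minus_eq by (simp add: closed_ideal_def)
qed

text \<open>Both products lie in each of the two ideals, which meet only in zero.\<close>

lemma ideal_mult_eq_zero: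
  assumes "closed_ideal A I" "closed_ideal A J" "internal_direct_sum A I J" "x \<in> I" "y \<in> J"
  shows "x \<otimes> y = \<zero>" and "y \<otimes> x = \<zero>"
  using assms unfolding closed_ideal_def internal_direct_sum_def by blast+

text \<open>The complement replaces the usual approximate unit. Write adj x = a + b; since b
  annihilates x, the product b adj a equals minus b adj b and is self-adjoint. It therefore equals
  its adjoint a adj b, lies in both ideals and vanishes. So b adj b = 0, and b = 0.\<close>

lemma direct_summand_adj_closed:
  assumes I: "closed_ideal A I" and J: "closed_ideal A J" and IJ: "internal_direct_sum A I J"
    and x: "x \<in> I"
  shows "adj A x \<in> I"
proof -
  note zero = ideal_mult_eq_zero[OF I J IJ]
  have sub: "I \<subseteq> carrier A" "J \<subseteq> carrier A" using I J by (auto simp: closed_ideal_def)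
  have xC: "x \<in> carrier A" using x sub by auto
  then have "adj A x \<in> I <+>\<^bsub>A\<^esub> J" using IJ by (simp add: internal_direct_sum_def adj_closed)
  then obtain a b where ab: "a \<in> I" "b \<in> J" "adj A x = a \<oplus> b" by (auto simp: set_add_def')
  have C: "a \<in> carrier A" "b \<in> carrier A" using ab sub by auto
  have "x = adj A a \<oplus> adj A b" using arg_cong[OF ab(3), of "adj A"] C xC by (simp add: adj_adj adj_add)
  then have sum: "b \<otimes> adj A a \<oplus> b \<otimes> adj A b = \<zero>"
    using zero(2)[OF x ab(2)] C by (simp add: distrib_left adj_closed)
  then have ba: "b \<otimes> adj A a = \<ominus> (b \<otimes> adj A b)"
    using C by (simp add: mult_closed adj_closed minus_equality)
  have "a \<otimes> adj A b = adj A (b \<otimes> adj A a)" using C by (simp add: adj_mult adj_closed adj_adj)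
  also have "\<dots> = b \<otimes> adj A a" unfolding ba using C by (simp add: adj_minus adj_mult adj_closed adj_adj mult_closed)
  finally have "a \<otimes> adj A b = b \<otimes> adj A a" .
  moreover have "a \<otimes> adj A b \<in> I" "b \<otimes> adj A a \<in> J"
    using I J ab C adj_closed by (auto simp: closed_ideal_def)
  ultimately have "b \<otimes> adj A a = \<zero>" using IJ by (auto simp: internal_direct_sum_def)
  then have "b \<otimes> adj A b = \<zero>" using sum C by (simp add: mult_closed adj_closed)
  then have "nrm A (adj A b) = 0"
    using cstar_identity[of "adj A b"] C by (simp add: adj_closed adj_adj nrm_zero)
  then have "b = \<zero>" using C by (simp add: nrm_adj nrm_eq_0)
  then show ?thesis using ab C by simp
qed

text \<open>Decompositions are unique, so each property of the first component follows by exhibiting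
  a decomposition. For products the cross terms vanish; for adjoints both ideals are
  self-adjoint.\<close>

lemma direct_summand_projection:
  assumes I: "closed_ideal A I" and J: "closed_ideal A J" and IJ: "internal_direct_sum A I J"
  obtains \<pi> where "\<pi> \<in> star_hom A A" "\<And>x. x \<in> carrier A \<Longrightarrow> \<pi> x \<in> I" "\<And>x. x \<in> I \<Longrightarrow> \<pi> x = x"
proof -
  have sub: "I \<subseteq> carrier A" "J \<subseteq> carrier A" using I J by (auto simp: closed_ideal_def)
  have "\<forall>x \<in> carrier A. \<exists>a b. a \<in> I \<and> b \<in> J \<and> x = a \<oplus> b"
  proof
    fix x assume "x \<in> carrier A"
    then have "x \<in> I <+>\<^bsub>A\<^esub> J" using IJ by (simp add: internal_direct_sum_def)
    then show "\<exists>a b. a \<in> I \<and> b \<in> J \<and> x = a \<oplus> b" by (auto simp: set_add_def')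
  qed
  then obtain p q where pq: "\<And>x. x \<in> carrier A \<Longrightarrow> p x \<in> I" "\<And>x. x \<in> carrier A \<Longrightarrow> q x \<in> J"
    "\<And>x. x \<in> carrier A \<Longrightarrow> x = p x \<oplus> q x" by metis
  have pqC: "p x \<in> carrier A" "q x \<in> carrier A" if "x \<in> carrier A" for x
    using pq[OF that] sub by auto
  have unique: "p x = a" if ab: "a \<in> I" "b \<in> J" "x = a \<oplus> b" for a b x
  proof -
    have C: "a \<in> carrier A" "b \<in> carrier A" "x \<in> carrier A" using ab sub by auto
    have "p x \<oplus> q x = a \<oplus> b" using pq(3)[OF C(3)] ab by simp
    then have "p x \<ominus> a = b \<ominus> q x"
      using C pqC[OF C(3)] by (metis a_comm add.inv_solve_left' add.inv_solve_right' a_assoc minus_eq a_inv_closed minus_closed)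
    then have "p x \<ominus> a \<in> I \<inter> J"
      using closed_ideal_minus[OF I pq(1)[OF C(3)] ab(1)] closed_ideal_minus[OF J ab(2) pq(2)[OF C(3)]] by simp
    then have "p x \<ominus> a = \<zero>" using IJ unfolding internal_direct_sum_def by blast
    then show ?thesis using C pqC by (simp add: minus_eq add.inv_solve_right')
  qed
  note zero = ideal_mult_eq_zero[OF I J IJ]
  have JI: "internal_direct_sum A J I" using internal_direct_sum_commute[OF sub IJ] .
  have "p \<in> star_hom A A"
    unfolding star_hom_def
  proof (intro CollectI conjI ballI allI)
    show "p \<in> carrier A \<rightarrow> carrier A" using pqC by auto
    fix x assume x: "x \<in> carrier A"
    have px: "p x \<in> carrier A" "q x \<in> carrier A" using pqC[OF x] .
    show "p (adj A x) = adj A (p x)"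
    proof (rule unique)
      show "adj A x = adj A (p x) \<oplus> adj A (q x)" using arg_cong[OF pq(3)[OF x], of "adj A"] px by (simp add: adj_add)
    qed (use direct_summand_adj_closed[OF I J IJ] direct_summand_adj_closed[OF J I JI] pq x in auto)
    show "p (a \<odot> x) = a \<odot> p x" for a
    proof (rule unique)
      show "a \<odot> x = a \<odot> p x \<oplus> a \<odot> q x"
        using arg_cong[OF pq(3)[OF x], of "\<lambda>x. a \<odot> x"] px by (simp add: smult_add_right)
    qed (use I J pq x in \<open>auto simp: closed_ideal_def\<close>)
    fix y assume y: "y \<in> carrier A"
    have py: "p y \<in> carrier A" "q y \<in> carrier A" using pqC[OF y] .
    show "p (x \<oplus> y) = p x \<oplus> p y"
    proof (rule unique)
      have "x \<oplus> y = (p x \<oplus> q x) \<oplus> (p y \<oplus> q y)" using pq(3) x y by simp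
      also have "\<dots> = (p x \<oplus> p y) \<oplus> (q x \<oplus> q y)" using px py by (simp add: a_ac)
      finally show "x \<oplus> y = (p x \<oplus> p y) \<oplus> (q x \<oplus> q y)" .
    qed (use I J pq x y in \<open>auto simp: closed_ideal_def\<close>)
    show "p (x \<otimes> y) = p x \<otimes> p y"
    proof (rule unique)
      have "x \<otimes> y = (p x \<oplus> q x) \<otimes> (p y \<oplus> q y)" using pq(3) x y by simp
      also have "\<dots> = p x \<otimes> p y \<oplus> q x \<otimes> q y"
        using px py zero(1)[OF pq(1)[OF x] pq(2)[OF y]] zero(2)[OF pq(1)[OF y] pq(2)[OF x]]
        by (simp add: distrib_left distrib_right mult_closed)
      finally show "x \<otimes> y = p x \<otimes> p y \<oplus> q x \<otimes> q y" .
    qed (use I J pq px py x y in \<open>auto simp: closed_ideal_def\<close>)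
  qed
  moreover have "p x = x" if "x \<in> I" for x
    using unique[OF that, of \<zero>] J that sub by (auto simp: closed_ideal_def)
  ultimately show thesis using that pq(1) by blast
qed

text \<open>The difference d of commuting idempotents satisfies d^3 = d. Its norm is thus at most
  its own cube, which is impossible strictly between 0 and 1.\<close>

lemma commuting_idempotents_eq:
  assumes e: "e \<in> carrier A" "e \<otimes> e = e" and f: "f \<in> carrier A" "f \<otimes> f = f"
    and ef: "e \<otimes> f = f \<otimes> e" and lt: "nrm A (e \<ominus> f) < 1"
  shows "e = f"
proof -
  define d where "d = e \<ominus> f"
  define m where "m = e \<otimes> f"
  have C: "d \<in> carrier A" "m \<in> carrier A" using e f by (auto simp: d_def m_def mult_closed)
  have m: "e \<otimes> m = m" "f \<otimes> m = m" "f \<otimes> e = m"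
    using e f ef by (simp_all add: m_def mult_assoc[symmetric]) (simp_all add: mult_assoc)
  have "d \<otimes> d = (e \<ominus> m) \<ominus> (m \<ominus> f)"
    using e f m C by (simp add: d_def alg_simps a_ac flip: m_def)
  then have "d \<otimes> (d \<otimes> d) = d"
    using e f m C by (simp add: d_def alg_simps add_cancel uminus_zero flip: m_def)
  then have "nrm A d \<le> nrm A d * (nrm A d * nrm A d)"
    using nrm_mult[of d "d \<otimes> d"] nrm_mult[of d d] C nrm_nonneg[of d]
    by (metis mult_closed mult_left_mono order_trans)
  moreover have "nrm A d * (nrm A d * nrm A d) \<le> nrm A d * nrm A d"
    using lt C nrm_nonneg[of d] by (simp add: d_def[symmetric] mult_left_le mult_left_mono)
  ultimately have "nrm A d * 1 \<le> nrm A d * nrm A d" by simp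
  moreover have "nrm A d * nrm A d < nrm A d * 1" if "nrm A d \<noteq> 0"
    using that lt C nrm_nonneg[of d] by (intro mult_strict_left_mono) (auto simp: d_def)
  ultimately have "nrm A d = 0" by force
  then have "d = \<zero>" using C by (simp add: nrm_eq_0)
  then show ?thesis using e f by (simp add: d_def minus_eq add.inv_solve_right')
qed

end

text \<open>In each coordinate, divide the argument by \<open>Suc n\<close>: the angles tend to
  zero, and the shift excludes a zeroth root.\<close>

lemma torus_roots_tendsto_one:
  assumes "t \<in> torus"
  obtains r :: "nat \<Rightarrow> complex ^ 'k::finite" where "\<And>n. r n \<in> torus"
    "\<And>n. t = (\<chi> i. r n $ i ^ Suc n)" "r \<longlonglongrightarrow> (\<chi> i. 1)"
proof
  define r :: "nat \<Rightarrow> complex ^ 'k" where "r n = (\<chi> i. cis (Arg (t $ i) * inverse (real (Suc n))))" for n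
  show "r n \<in> torus" for n by (simp add: r_def torus_def)
  show "t = (\<chi> i. r n $ i ^ Suc n)" for n
  proof (rule iffD2[OF vec_eq_iff], rule allI)
    fix i
    have "t $ i = cis (Arg (t $ i))"
      using rcis_cmod_Arg[of "t $ i"] assms by (simp add: torus_def rcis_def)
    also have "Arg (t $ i) = real (Suc n) * (Arg (t $ i) * inverse (real (Suc n)))" by simp
    also have "cis (real (Suc n) * (Arg (t $ i) * inverse (real (Suc n)))) =
        cis (Arg (t $ i) * inverse (real (Suc n))) ^ Suc n" by (rule Complex.DeMoivre[symmetric])
    finally show "t $ i = (\<chi> i. r n $ i ^ Suc n) $ i" by (simp only: r_def vec_lambda_beta)
  qed
  show "r \<longlonglongrightarrow> (\<chi> i. 1)"
  proof (rule vec_tendstoI)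
    fix i
    have "(\<lambda>n. Arg (t $ i) * inverse (real (Suc n))) \<longlonglongrightarrow> Arg (t $ i) * 0"
      by (intro tendsto_mult tendsto_const LIMSEQ_inverse_real_of_nat)
    then have "(\<lambda>n. cis (Arg (t $ i) * inverse (real (Suc n)))) \<longlonglongrightarrow> cis (Arg (t $ i) * 0)"
      by (rule tendsto_cis)
    then show "(\<lambda>n. r n $ i) \<longlonglongrightarrow> (\<chi> i. 1) $ i" by (simp add: r_def)
  qed
qed

section \<open>Gauge invariance of direct summands\<close>

context graph_algebra
begin

lemma gauge_action_vertex_component:
  assumes I: "closed_ideal C I" and \<pi>: "\<pi> \<in> star_hom C C"
    and \<pi>I: "\<And>x. x \<in> carrier C \<Longrightarrow> \<pi> x \<in> I" "\<And>x. x \<in> I \<Longrightarrow> \<pi> x = x"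
    and v: "v \<in> vertices \<Lambda>" and t: "t \<in> torus"
  shows "\<gamma> t (\<pi> (S v)) = \<pi> (S v)"
proof -
  define a where "a = \<pi> (S v)"
  have vm: "v \<in> mor \<Lambda>" using v by (simp add: vertices_def paths_def)
  have SvC: "S v \<in> carrier C" using vm by (rule S_closed)
  have aI: "a \<in> I" and aC: "a \<in> carrier C"
    using \<pi>I(1)[OF SvC] I by (auto simp: a_def closed_ideal_def)
  have "S v \<otimes>\<^bsub>C\<^esub> S v = S v" using ck v by (simp add: ck_family_def)
  then have aa: "a \<otimes>\<^bsub>C\<^esub> a = a" using star_homD(3)[OF \<pi> SvC SvC] by (simp add: a_def)
  have ideal: "x \<otimes>\<^bsub>C\<^esub> y \<in> I" "y \<otimes>\<^bsub>C\<^esub> x \<in> I" if "x \<in> I" "y \<in> carrier C" for x y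
    using I that by (auto simp: closed_ideal_def)
  \<comment> \<open>Both products lie in \<open>I\<close> and are fixed by \<pi>, and \<pi> sends
    each of them to a a = a.\<close>
  have pa: "S v \<otimes>\<^bsub>C\<^esub> a = a" "a \<otimes>\<^bsub>C\<^esub> S v = a"
    using \<pi>I(2)[OF ideal(2)[OF aI SvC]] \<pi>I(2)[OF ideal(1)[OF aI SvC]] \<pi>I(2)[OF aI] aa
    by (simp_all add: star_homD(3)[OF \<pi>] SvC aC flip: a_def)
  have fixed: "\<gamma> s a = a" if s: "s \<in> torus" and lt: "nrm C (\<gamma> s a \<ominus>\<^bsub>C\<^esub> a) < 1" for s
  proof (rule C.commuting_idempotents_eq[OF _ _ aC aa _ lt])
    note hom = star_homD[OF gauge_action_star_hom[OF s]]
    define x where "x = \<gamma> s a"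
    show xC: "\<gamma> s a \<in> carrier C" using aC by (rule hom(1))
    show "\<gamma> s a \<otimes>\<^bsub>C\<^esub> \<gamma> s a = \<gamma> s a" using hom(3)[OF aC aC] aa by simp
    have px: "S v \<otimes>\<^bsub>C\<^esub> x = x" "x \<otimes>\<^bsub>C\<^esub> S v = x"
      using hom(3)[OF SvC aC] hom(3)[OF aC SvC] pa gauge_action_vertex[OF s v] by (simp_all add: x_def)
    have xC': "x \<in> carrier C" using xC by (simp add: x_def)
    \<comment> \<open>Commutation: a x lies in \<open>I\<close>, so a x = \<pi> (a x) = a \<pi> x =
      \<pi> (S v x) = \<pi> x, and symmetrically for x a. The last equality uses that
      \<open>x\<close> stays below \<open>S v\<close>.\<close>
    have "a \<otimes>\<^bsub>C\<^esub> x = \<pi> x" "x \<otimes>\<^bsub>C\<^esub> a = \<pi> x"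
      using \<pi>I(2)[OF ideal(1)[OF aI xC']] \<pi>I(2)[OF ideal(2)[OF aI xC']] \<pi>I(2)[OF aI]
        star_homD(3)[OF \<pi> SvC xC'] star_homD(3)[OF \<pi> xC' SvC] xC' aC px
      by (simp_all add: star_homD(3)[OF \<pi>] flip: a_def)
    then show "\<gamma> s a \<otimes>\<^bsub>C\<^esub> a = a \<otimes>\<^bsub>C\<^esub> \<gamma> s a" by (simp add: x_def)
  qed
  obtain r where r: "\<And>n. r n \<in> torus" "\<And>n. t = (\<chi> i. r n $ i ^ Suc n)" "r \<longlonglongrightarrow> (\<chi> i. 1)"
    by (rule torus_roots_tendsto_one[OF t]) (rule that)
  have "(\<lambda>n. nrm C (\<gamma> (r n) a \<ominus>\<^bsub>C\<^esub> a)) \<longlonglongrightarrow> 0"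
    by (rule C.limitinD[OF gauge_action_tendsto[OF r(1,3) aC]])
  then have "\<forall>\<^sub>F n in sequentially. nrm C (\<gamma> (r n) a \<ominus>\<^bsub>C\<^esub> a) < 1"
    by (rule order_tendstoD(2)) simp
  \<comment> \<open>A root of \<open>t\<close> so close to 1 that its action moves \<open>a\<close>
    by less than one; its power with exponent \<open>Suc n\<close> is \<open>t\<close>
    itself.\<close>
  then obtain n where "nrm C (\<gamma> (r n) a \<ominus>\<^bsub>C\<^esub> a) < 1"
    using eventually_happens' sequentially_bot by blast
  then have n: "\<gamma> (r n) a = a" by (rule fixed[OF r(1)])
  have "\<gamma> (\<chi> i. r n $ i ^ Suc m) a = a" for m
  proof (induction m)
    case 0
    then show ?case using n by (simp add: vec_lambda_eta)
  next
    case (Suc m)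
    have "(\<chi> i. r n $ i ^ Suc m) \<in> torus" using r(1)[of n] by (simp add: torus_def norm_power norm_mult)
    from gauge_action_mult[OF r(1)[of n] this aC] Suc n show ?case by simp
  qed
  from this[of n] show ?thesis by (simp only: a_def flip: r(2))
qed

theorem direct_summand_gauge_invariant:
  assumes I: "closed_ideal C I" and J: "closed_ideal C J" and IJ: "internal_direct_sum C I J"
  shows "gauge_invariant \<Lambda> C S I"
  unfolding gauge_invariant_def
proof (intro ballI subsetI)
  fix t y assume t: "t \<in> torus" and "y \<in> \<gamma> t ` I"
  then obtain x where x: "x \<in> I" "y = \<gamma> t x" by auto
  then have xC: "x \<in> carrier C" using I by (auto simp: closed_ideal_def)
  obtain \<pi> where \<pi>: "\<pi> \<in> star_hom C C" and \<pi>I: "\<And>x. x \<in> carrier C \<Longrightarrow> \<pi> x \<in> I" "\<And>x. x \<in> I \<Longrightarrow> \<pi> x = x"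
    using C.direct_summand_projection[OF I J IJ] by blast
  note hom = gauge_action_star_hom[OF t]
  have "\<gamma> t (\<pi> x) = \<pi> (\<gamma> t x)"
  proof (rule star_hom_eqI[OF star_hom_comp[OF \<pi> hom] star_hom_comp[OF hom \<pi>] _ xC])
    fix l assume l: "l \<in> mor \<Lambda>"
    let ?v = "src \<Lambda> l"
    have v: "?v \<in> vertices \<Lambda>" "?v \<in> mor \<Lambda>" using l by (simp_all add: vertices_iff_identity src_mor rng_src)
    have Sl: "S l \<in> carrier C" and Sv: "S ?v \<in> carrier C" using S_closed l v by auto
    have a: "\<pi> (S ?v) \<in> I" "\<pi> (S ?v) \<in> carrier C"
      using \<pi>I(1)[OF Sv] star_homD(1)[OF \<pi> Sv] .
    have "S l \<otimes>\<^bsub>C\<^esub> S ?v = S l" using ck l v by (simp add: ck_family_def rng_src cmp_src)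
    \<comment> \<open>The factor \<pi> (S l) can be replaced by \<open>S l\<close>: the product of
      \<open>S l\<close> with \<pi> (S ?v) already lies in \<open>I\<close>, so \<pi> fixes
      it.\<close>
    then have "\<pi> (S l) = \<pi> (S l) \<otimes>\<^bsub>C\<^esub> \<pi> (S ?v)" using star_homD(3)[OF \<pi> Sl Sv] by simp
    also have "\<dots> = \<pi> (S l \<otimes>\<^bsub>C\<^esub> \<pi> (S ?v))"
      using \<pi>I(2)[OF a(1)] a(2) Sl by (simp add: star_homD(3)[OF \<pi>])
    also have "\<dots> = S l \<otimes>\<^bsub>C\<^esub> \<pi> (S ?v)"
      using I a Sl by (intro \<pi>I(2)) (simp add: closed_ideal_def)
    finally have eq: "\<pi> (S l) = S l \<otimes>\<^bsub>C\<^esub> \<pi> (S ?v)" .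
    have "\<gamma> t (\<pi> (S l)) = torus_power t (deg \<Lambda> l) \<odot>\<^bsub>C\<^esub> (S l \<otimes>\<^bsub>C\<^esub> \<pi> (S ?v))"
      using gauge_action_vertex_component[OF I \<pi> \<pi>I v(1) t] Sl a(2) l
      by (simp add: eq star_homD(3)[OF hom] gauge_action_generator[OF t] C.smult_mult_left)
    then show "\<gamma> t (\<pi> (S l)) = \<pi> (\<gamma> t (S l))"
      using l Sl by (simp add: gauge_action_generator[OF t] star_homD(4)[OF \<pi>] flip: eq)
  qed
  then have "y = \<pi> (\<gamma> t x)" using \<pi>I(2)[OF x(1)] x(2) by simp
  then show "y \<in> I" using \<pi>I(1)[OF gauge_action_closed[OF t xC]] by simp
qed

end

theorem corollary6p4:
  fixes \<Lambda> :: "('l, 'k::finite) kgraph_data"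
    and C :: "'a cstar"
    and S :: "'l \<Rightarrow> 'a"
    and A B :: "'a set"
  assumes "kgraph \<Lambda>" and "locally_convex \<Lambda>" and "row_finite \<Lambda>"
    and "graph_cstar_algebra \<Lambda> C S"
    and "closed_ideal C A" and "closed_ideal C B"
    and "internal_direct_sum C A B"
  shows "gauge_invariant \<Lambda> C S A \<and> gauge_invariant \<Lambda> C S B"
proof -
  have "graph_algebra \<Lambda> C S"
    using assms(1,4) by (auto simp: graph_algebra_def graph_algebra_axioms_def graph_cstar_algebra_def)
  then interpret graph_algebra \<Lambda> C S .
  have "internal_direct_sum C B A"
    using assms(5-7) by (auto simp: closed_ideal_def intro: C.internal_direct_sum_commute[of A B])
  then show ?thesis
    by (intro conjI direct_summand_gauge_invariant[OF assms(5-7)]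
        direct_summand_gauge_invariant[OF assms(6,5)])
qed

end
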